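(* Let $k$ be a commutative artinian ring with unit and let $\mathcal{C}$ be a nonzero skeletally small Hom-finite $k$-linear abelian category having Serre duality. Then a morphism in $\mathcal{C}$ that is not an epimorphism is not right determined by any object, and thus $\mathcal{C}$ does not have right determined morphisms. Moreover, $\mathcal{C}$ is not a dualizing $k$-variety.
   Context: Let $k\text{-mod}$ be the category of finitely generated $k$-modules, $E$ the minimal injective cogenerator of $k$, and $D=\mathrm{Hom}_k(-,E)$ the resulting duality on $k\text{-mod}$. A $k$-linear category is Hom-finite if every $\mathrm{Hom}_\mathcal{C}(X,Y)$ is a finitely generated $k$-module; it is skeletally small if the isomorphism classes of objects form a set. A Hom-finite $k$-linear abelian category $\mathcal{C}$ has Serre duality if there is a $k$-linear auto-equivalence $\tau\colon\mathcal{C}\to\mathcal{C}$ together with a functorial isomorphism $D\,\mathrm{Ext}^1_\mathcal{C}(X,Y)\simeq \mathrm{Hom}_\mathcal{C}(Y,\tau(X))$ for all objects $X,Y$. For an object $C$ put $\Gamma(C)=\mathrm{End}_\mathcal{C}(C)^{\rm op}$; each $\mathrm{Hom}_\mathcal{C}(C,X)$ is a left $\Gamma(C)$-module via precomposition. For $\alpha\colon X\to Y$, $\mathrm{Im}\,\mathrm{Hom}_\mathcal{C}(C,\alpha)\subseteq\mathrm{Hom}_\mathcal{C}(C,Y)$ denotes the image of the induced map $\mathrm{Hom}_\mathcal{C}(C,X)\to\mathrm{Hom}_\mathcal{C}(C,Y)$. The morphism $\alpha$ is right determined by $C$ if every $t\colon T\to Y$ with $\mathrm{Im}\,\mathrm{Hom}_\mathcal{C}(C,t)\subseteq\mathrm{Im}\,\mathrm{Hom}_\mathcal{C}(C,\alpha)$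 factors as $t=\alpha\circ t'$ for some $t'\colon T\to X$. For a $\Gamma(C)$-submodule $H\subseteq\mathrm{Hom}_\mathcal{C}(C,Y)$, the pair $(C,H)$ is right represented by $\alpha\colon X\to Y$ if $\alpha$ is right determined by $C$ and $H=\mathrm{Im}\,\mathrm{Hom}_\mathcal{C}(C,\alpha)$. $\mathcal{C}$ has right determined morphisms if for every object $Y$: (RC1) each morphism $\alpha\colon X\to Y$ ending at $Y$ is right determined by some object $C$; and (RC2) for any object $C$ and any $\Gamma(C)$-submodule $H$ of $\mathrm{Hom}_\mathcal{C}(C,Y)$, the pair $(C,H)$ is right represented by some morphism $\alpha\colon X\to Y$. A $k$-linear functor $F\colon\mathcal{C}^{\rm op}\to k\text{-mod}$ is finitely presented if there is an exact sequence of functors $\mathrm{Hom}_\mathcal{C}(-,X)\to\mathrm{Hom}_\mathcal{C}(-,Y)\to F\to 0$ for some objects $X,Y$; a $k$-linear functor $G\colon\mathcal{C}\to k\text{-mod}$ is finitely presented if there is an exact sequence $\mathrm{Hom}_\mathcal{C}(X,-)\to\mathrm{Hom}_\mathcal{C}(Y,-)\to G\to 0$. $\mathcal{C}$ is a dualizing $k$-variety if any $k$-linear functor $F\colon\mathcal{C}^{\rm op}\to k\text{-mod}$ is finitely presented if and only if its dual $DF\colon\mathcal{C}\to k\text{-mod}$ is finitely presented. *)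

theory Defs
  imports "HOL-Algebra.Module" "HOL-Algebra.Ideal"
begin

definition artinian_cring :: "'k ring \<Rightarrow> bool" where
  "artinian_cring k \<longleftrightarrow> cring k \<and>
     (\<forall>I :: nat \<Rightarrow> 'k set. (\<forall>n. ideal (I n) k) \<and> (\<forall>n. I (Suc n) \<subseteq> I n)
        \<longrightarrow> (\<exists>N. \<forall>n\<ge>N. I n = I N))"

definition lin_maps :: "'k ring \<Rightarrow> ('k, 'u) module \<Rightarrow> ('k, 'v) module \<Rightarrow> ('u \<Rightarrow> 'v) set" where
  "lin_maps k M N = {f. f \<in> hom (add_monoid M) (add_monoid N) \<and>
     (\<forall>c\<in>carrier k. \<forall>x\<in>carrier M. f (c \<odot>\<^bsub>M\<^esub> x) = c \<odot>\<^bsub>N\<^esub> f x)}"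

definition lin_isos :: "'k ring \<Rightarrow> ('k, 'u) module \<Rightarrow> ('k, 'v) module \<Rightarrow> ('u \<Rightarrow> 'v) set" where
  "lin_isos k M N = {f \<in> lin_maps k M N. bij_betw f (carrier M) (carrier N)}"

definition fg_module :: "'k ring \<Rightarrow> ('k, 'u) module \<Rightarrow> bool" where
  "fg_module k M \<longleftrightarrow> module k M \<and>
     (\<exists>S. finite S \<and> S \<subseteq> carrier M \<and> (\<forall>N. submodule N k M \<and> S \<subseteq> N \<longrightarrow> N = carrier M))"

text \<open>
  HOL cannot quantify over types inside a definition, so wherever a definition ranges over
  all \<open>k\<close>-modules or over all functors to finitely generated \<open>k\<close>-modules, the elements of the
  modules are taken from the following type. It contains an isomorphic copy of every
  finitely generated \<open>k\<close>-module (a coset of a submodule of \<open>k\<^sup>n\<close> is a set of coefficient vectors)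
  and in particular of every ideal of \<open>k\<close> and every cyclic module. By Baer's criterion the
  notions of injective module and of injective cogenerator below therefore do not depend on
  this choice, and every functor to finitely generated modules is isomorphic to one with values
  in modules of this kind.
\<close>

type_synonym 'k univ_elt = "(nat \<Rightarrow> 'k) set"

definition injective_module :: "'k ring \<Rightarrow> ('k, 'e) module \<Rightarrow> bool" where
  "injective_module k E \<longleftrightarrow> module k E \<and>
     (\<forall>(M :: ('k, 'k univ_elt) module) (N :: ('k, 'k univ_elt) module) f g.
        module k M \<and> module k N \<and> f \<in> lin_maps k M N \<and> inj_on f (carrier M) \<and> g \<in> lin_maps k M E
        \<longrightarrow> (\<exists>h\<in>lin_maps k N E. \<forall>x\<in>carrier M. h (f x) = g x))"

text \<open>A cogenerator is an object \<open>E\<close> with \<open>Hom(-, E)\<close> faithful.\<close>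

definition cogenerator_module :: "'k ring \<Rightarrow> ('k, 'e) module \<Rightarrow> bool" where
  "cogenerator_module k E \<longleftrightarrow> module k E \<and>
     (\<forall>(M :: ('k, 'k univ_elt) module) (N :: ('k, 'k univ_elt) module) f g.
        module k M \<and> module k N \<and> f \<in> lin_maps k M N \<and> g \<in> lin_maps k M N \<and>
        (\<exists>x\<in>carrier M. f x \<noteq> g x)
        \<longrightarrow> (\<exists>h\<in>lin_maps k N E. \<exists>x\<in>carrier M. h (f x) \<noteq> h (g x)))"

text \<open>
  Minimality is with respect to inclusion: no proper submodule is an injective cogenerator.
  Over a commutative artinian ring this singles out, up to isomorphism, the injective hull of
  the direct sum of representatives of the simple modules.
\<close>

definition minimal_injective_cogenerator :: "'k ring \<Rightarrow> ('k, 'e) module \<Rightarrow> bool" where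
  "minimal_injective_cogenerator k E \<longleftrightarrow>
     injective_module k E \<and> cogenerator_module k E \<and>
     (\<forall>N. submodule N k E \<and> injective_module k (E\<lparr>carrier := N\<rparr>) \<and>
          cogenerator_module k (E\<lparr>carrier := N\<rparr>) \<longrightarrow> N = carrier E)"

text \<open>
  \<open>dual k E M\<close> is \<open>Hom\<^sub>k(M, E)\<close>; maps are extensional so that a linear map is determined by its
  values on the carrier. The fields \<open>mult\<close> and \<open>one\<close>, inherited from the record of rings, play no
  role for modules.
\<close>

definition dual :: "'k ring \<Rightarrow> ('k, 'e) module \<Rightarrow> ('k, 'u) module \<Rightarrow> ('k, 'u \<Rightarrow> 'e) module" where
  "dual k E M = \<lparr>carrier = lin_maps k M E \<inter> extensional (carrier M),
     monoid.mult = undefined, one = undefined,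
     ring.zero = (\<lambda>x\<in>carrier M. \<zero>\<^bsub>E\<^esub>),
     ring.add = (\<lambda>l l'. \<lambda>x\<in>carrier M. l x \<oplus>\<^bsub>E\<^esub> l' x),
     smult = (\<lambda>c l. \<lambda>x\<in>carrier M. c \<odot>\<^bsub>E\<^esub> l x)\<rparr>"


text \<open>
  Skeletal smallness needs no hypothesis: the objects form a HOL set, so there is a set of
  isomorphism classes. Hom-modules are not required to be disjoint, and composition
  \<open>cmp C g f\<close> (first \<open>f\<close>, then \<open>g\<close>) is a single
  function on morphisms. This covers every category whose morphisms know their source and target.
\<close>

record ('k, 'o, 'm) lincat =
  Obj :: "'o set"
  Hom :: "'o \<Rightarrow> 'o \<Rightarrow> ('k, 'm) module"
  cmp :: "'m \<Rightarrow> 'm \<Rightarrow> 'm" (infixl \<open>\<cdot>\<index>\<close> 70)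
  ident :: "'o \<Rightarrow> 'm"

abbreviation mor :: "('k, 'o, 'm) lincat \<Rightarrow> 'o \<Rightarrow> 'o \<Rightarrow> 'm set" where
  "mor C X Y \<equiv> carrier (Hom C X Y)"

locale klinear_category =
  fixes k :: "'k ring" and C :: "('k, 'o, 'm) lincat" (structure)
  assumes hom_module: "\<lbrakk>X \<in> Obj C; Y \<in> Obj C\<rbrakk> \<Longrightarrow> module k (Hom C X Y)"
    and cmp_closed: "\<lbrakk>X \<in> Obj C; Y \<in> Obj C; Z \<in> Obj C; f \<in> mor C X Y; g \<in> mor C Y Z\<rbrakk>
      \<Longrightarrow> g \<cdot> f \<in> mor C X Z"
    and ident_closed: "X \<in> Obj C \<Longrightarrow> ident C X \<in> mor C X X"
    and cmp_ident: "\<lbrakk>X \<in> Obj C; Y \<in> Obj C; f \<in> mor C X Y\<rbrakk> \<Longrightarrow> f \<cdot> ident C X = f"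
    and ident_cmp: "\<lbrakk>X \<in> Obj C; Y \<in> Obj C; f \<in> mor C X Y\<rbrakk> \<Longrightarrow> ident C Y \<cdot> f = f"
    and cmp_assoc: "\<lbrakk>X \<in> Obj C; Y \<in> Obj C; Z \<in> Obj C; W \<in> Obj C;
      f \<in> mor C X Y; g \<in> mor C Y Z; h \<in> mor C Z W\<rbrakk> \<Longrightarrow> h \<cdot> (g \<cdot> f) = (h \<cdot> g) \<cdot> f"
    and cmp_add_right: "\<lbrakk>X \<in> Obj C; Y \<in> Obj C; Z \<in> Obj C; f \<in> mor C X Y; f' \<in> mor C X Y; g \<in> mor C Y Z\<rbrakk>
      \<Longrightarrow> g \<cdot> (f \<oplus>\<^bsub>Hom C X Y\<^esub> f') = g \<cdot> f \<oplus>\<^bsub>Hom C X Z\<^esub> g \<cdot> f'"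
    and cmp_add_left: "\<lbrakk>X \<in> Obj C; Y \<in> Obj C; Z \<in> Obj C; f \<in> mor C X Y; g \<in> mor C Y Z; g' \<in> mor C Y Z\<rbrakk>
      \<Longrightarrow> (g \<oplus>\<^bsub>Hom C Y Z\<^esub> g') \<cdot> f = g \<cdot> f \<oplus>\<^bsub>Hom C X Z\<^esub> g' \<cdot> f"
    and cmp_smult_right: "\<lbrakk>X \<in> Obj C; Y \<in> Obj C; Z \<in> Obj C; c \<in> carrier k; f \<in> mor C X Y; g \<in> mor C Y Z\<rbrakk>
      \<Longrightarrow> g \<cdot> (c \<odot>\<^bsub>Hom C X Y\<^esub> f) = c \<odot>\<^bsub>Hom C X Z\<^esub> (g \<cdot> f)"
    and cmp_smult_left: "\<lbrakk>X \<in> Obj C; Y \<in> Obj C; Z \<in> Obj C; c \<in> carrier k; f \<in> mor C X Y; g \<in> mor C Y Z\<rbrakk>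
      \<Longrightarrow> (c \<odot>\<^bsub>Hom C Y Z\<^esub> g) \<cdot> f = c \<odot>\<^bsub>Hom C X Z\<^esub> (g \<cdot> f)"

definition hom_finite :: "'k ring \<Rightarrow> ('k, 'o, 'm) lincat \<Rightarrow> bool" where
  "hom_finite k C \<longleftrightarrow> (\<forall>X\<in>Obj C. \<forall>Y\<in>Obj C. fg_module k (Hom C X Y))"

definition op_cat :: "('k, 'o, 'm) lincat \<Rightarrow> ('k, 'o, 'm) lincat" where
  "op_cat C = \<lparr>Obj = Obj C, Hom = (\<lambda>X Y. Hom C Y X), cmp = (\<lambda>g f. f \<cdot>\<^bsub>C\<^esub> g), ident = ident C\<rparr>"

definition is_mono :: "('k, 'o, 'm) lincat \<Rightarrow> 'o \<Rightarrow> 'o \<Rightarrow> 'm \<Rightarrow> bool" where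
  "is_mono C X Y f \<longleftrightarrow> f \<in> mor C X Y \<and>
     (\<forall>T\<in>Obj C. \<forall>s\<in>mor C T X. \<forall>t\<in>mor C T X. f \<cdot>\<^bsub>C\<^esub> s = f \<cdot>\<^bsub>C\<^esub> t \<longrightarrow> s = t)"

definition is_epi :: "('k, 'o, 'm) lincat \<Rightarrow> 'o \<Rightarrow> 'o \<Rightarrow> 'm \<Rightarrow> bool" where
  "is_epi C X Y f \<longleftrightarrow> f \<in> mor C X Y \<and>
     (\<forall>T\<in>Obj C. \<forall>s\<in>mor C Y T. \<forall>t\<in>mor C Y T. s \<cdot>\<^bsub>C\<^esub> f = t \<cdot>\<^bsub>C\<^esub> f \<longrightarrow> s = t)"

definition is_iso :: "('k, 'o, 'm) lincat \<Rightarrow> 'o \<Rightarrow> 'o \<Rightarrow> 'm \<Rightarrow> bool" where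
  "is_iso C X Y f \<longleftrightarrow> f \<in> mor C X Y \<and>
     (\<exists>g\<in>mor C Y X. g \<cdot>\<^bsub>C\<^esub> f = ident C X \<and> f \<cdot>\<^bsub>C\<^esub> g = ident C Y)"

definition is_zero_object :: "('k, 'o, 'm) lincat \<Rightarrow> 'o \<Rightarrow> bool" where
  "is_zero_object C Z \<longleftrightarrow> Z \<in> Obj C \<and>
     (\<forall>X\<in>Obj C. (\<exists>!f. f \<in> mor C X Z) \<and> (\<exists>!f. f \<in> mor C Z X))"

definition is_biproduct ::
    "('k, 'o, 'm) lincat \<Rightarrow> 'o \<Rightarrow> 'o \<Rightarrow> 'o \<Rightarrow> 'm \<Rightarrow> 'm \<Rightarrow> 'm \<Rightarrow> 'm \<Rightarrow> bool" where
  "is_biproduct C X Y S i1 i2 p1 p2 \<longleftrightarrow> S \<in> Obj C \<and>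
     i1 \<in> mor C X S \<and> i2 \<in> mor C Y S \<and> p1 \<in> mor C S X \<and> p2 \<in> mor C S Y \<and>
     p1 \<cdot>\<^bsub>C\<^esub> i1 = ident C X \<and> p2 \<cdot>\<^bsub>C\<^esub> i2 = ident C Y \<and>
     p1 \<cdot>\<^bsub>C\<^esub> i2 = \<zero>\<^bsub>Hom C Y X\<^esub> \<and> p2 \<cdot>\<^bsub>C\<^esub> i1 = \<zero>\<^bsub>Hom C X Y\<^esub> \<and>
     i1 \<cdot>\<^bsub>C\<^esub> p1 \<oplus>\<^bsub>Hom C S S\<^esub> i2 \<cdot>\<^bsub>C\<^esub> p2 = ident C S"

definition is_kernel :: "('k, 'o, 'm) lincat \<Rightarrow> 'o \<Rightarrow> 'o \<Rightarrow> 'm \<Rightarrow> 'o \<Rightarrow> 'm \<Rightarrow> bool" where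
  "is_kernel C X Y f K j \<longleftrightarrow> K \<in> Obj C \<and> j \<in> mor C K X \<and> f \<cdot>\<^bsub>C\<^esub> j = \<zero>\<^bsub>Hom C K Y\<^esub> \<and>
     (\<forall>T\<in>Obj C. \<forall>t\<in>mor C T X. f \<cdot>\<^bsub>C\<^esub> t = \<zero>\<^bsub>Hom C T Y\<^esub> \<longrightarrow>
        (\<exists>!s. s \<in> mor C T K \<and> j \<cdot>\<^bsub>C\<^esub> s = t))"

definition is_cokernel :: "('k, 'o, 'm) lincat \<Rightarrow> 'o \<Rightarrow> 'o \<Rightarrow> 'm \<Rightarrow> 'o \<Rightarrow> 'm \<Rightarrow> bool" where
  "is_cokernel C X Y f Q q \<longleftrightarrow> Q \<in> Obj C \<and> q \<in> mor C Y Q \<and> q \<cdot>\<^bsub>C\<^esub> f = \<zero>\<^bsub>Hom C X Q\<^esub> \<and>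
     (\<forall>T\<in>Obj C. \<forall>t\<in>mor C Y T. t \<cdot>\<^bsub>C\<^esub> f = \<zero>\<^bsub>Hom C X T\<^esub> \<longrightarrow>
        (\<exists>!s. s \<in> mor C Q T \<and> s \<cdot>\<^bsub>C\<^esub> q = t))"

definition is_pullback ::
    "('k, 'o, 'm) lincat \<Rightarrow> 'o \<Rightarrow> 'o \<Rightarrow> 'm \<Rightarrow> 'm \<Rightarrow> 'o \<Rightarrow> 'm \<Rightarrow> 'm \<Rightarrow> bool" where
  "is_pullback C B B' p p' P q q' \<longleftrightarrow> P \<in> Obj C \<and> q \<in> mor C P B \<and> q' \<in> mor C P B' \<and>
     p \<cdot>\<^bsub>C\<^esub> q = p' \<cdot>\<^bsub>C\<^esub> q' \<and>
     (\<forall>T\<in>Obj C. \<forall>t\<in>mor C T B. \<forall>t'\<in>mor C T B'. p \<cdot>\<^bsub>C\<^esub> t = p' \<cdot>\<^bsub>C\<^esub> t' \<longrightarrow>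
        (\<exists>!s. s \<in> mor C T P \<and> q \<cdot>\<^bsub>C\<^esub> s = t \<and> q' \<cdot>\<^bsub>C\<^esub> s = t'))"

definition abelian_category :: "'k ring \<Rightarrow> ('k, 'o, 'm) lincat \<Rightarrow> bool" where
  "abelian_category k C \<longleftrightarrow> klinear_category k C \<and>
     (\<exists>Z. is_zero_object C Z) \<and>
     (\<forall>X\<in>Obj C. \<forall>Y\<in>Obj C. \<exists>S i1 i2 p1 p2. is_biproduct C X Y S i1 i2 p1 p2) \<and>
     (\<forall>X\<in>Obj C. \<forall>Y\<in>Obj C. \<forall>f\<in>mor C X Y.
        (\<exists>K j. is_kernel C X Y f K j) \<and> (\<exists>Q q. is_cokernel C X Y f Q q)) \<and>
     (\<forall>X\<in>Obj C. \<forall>Y\<in>Obj C. \<forall>f. is_mono C X Y f \<longrightarrow>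
        (\<exists>Z\<in>Obj C. \<exists>g\<in>mor C Y Z. is_kernel C Y Z g X f)) \<and>
     (\<forall>X\<in>Obj C. \<forall>Y\<in>Obj C. \<forall>f. is_epi C X Y f \<longrightarrow>
        (\<exists>Z\<in>Obj C. \<exists>g\<in>mor C Z X. is_cokernel C Z X g Y f))"


text \<open>An extension of \<open>X\<close> by \<open>Y\<close> is a triple \<open>(i, B, p)\<close> with \<open>0 \<rightarrow> Y \<rightarrow> B \<rightarrow> X \<rightarrow> 0\<close> exact.\<close>

type_synonym ('o, 'm) extn = "'m \<times> 'o \<times> 'm"

definition extensions :: "('k, 'o, 'm) lincat \<Rightarrow> 'o \<Rightarrow> 'o \<Rightarrow> ('o, 'm) extn set" where
  "extensions C X Y = {(i, B, p). B \<in> Obj C \<and> i \<in> mor C Y B \<and> p \<in> mor C B X \<and>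
     is_kernel C B X p Y i \<and> is_cokernel C Y B i X p}"

definition ext_equiv ::
    "('k, 'o, 'm) lincat \<Rightarrow> 'o \<Rightarrow> 'o \<Rightarrow> (('o, 'm) extn \<times> ('o, 'm) extn) set" where
  "ext_equiv C X Y = {((i, B, p), (i', B', p')).
     (i, B, p) \<in> extensions C X Y \<and> (i', B', p') \<in> extensions C X Y \<and>
     (\<exists>b. is_iso C B B' b \<and> b \<cdot>\<^bsub>C\<^esub> i = i' \<and> p' \<cdot>\<^bsub>C\<^esub> b = p)}"

text \<open>
  Push-out of the extension class \<open>\<xi>\<close> of \<open>X\<close> by \<open>Y\<close> along \<open>a : Y \<rightarrow> Y'\<close>, and pull-back
  along \<open>c : X' \<rightarrow> X\<close>, as sets of all extensions receiving (respectively mapping to) a member of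
  \<open>\<xi>\<close> by a morphism of extensions over \<open>a\<close> and the identity (the identity and \<open>c\<close>).
\<close>

definition ext_push ::
    "('k, 'o, 'm) lincat \<Rightarrow> 'o \<Rightarrow> 'o \<Rightarrow> 'm \<Rightarrow> ('o, 'm) extn set \<Rightarrow> ('o, 'm) extn set" where
  "ext_push C X Y' a \<xi> = {(i', B', p'). (i', B', p') \<in> extensions C X Y' \<and>
     (\<exists>(i, B, p)\<in>\<xi>. \<exists>b\<in>mor C B B'. b \<cdot>\<^bsub>C\<^esub> i = i' \<cdot>\<^bsub>C\<^esub> a \<and> p' \<cdot>\<^bsub>C\<^esub> b = p)}"

definition ext_pull ::
    "('k, 'o, 'm) lincat \<Rightarrow> 'o \<Rightarrow> 'o \<Rightarrow> 'm \<Rightarrow> ('o, 'm) extn set \<Rightarrow> ('o, 'm) extn set" where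
  "ext_pull C X' Y c \<xi> = {(i', B', p'). (i', B', p') \<in> extensions C X' Y \<and>
     (\<exists>(i, B, p)\<in>\<xi>. \<exists>b\<in>mor C B' B. b \<cdot>\<^bsub>C\<^esub> i' = i \<and> p \<cdot>\<^bsub>C\<^esub> b = c \<cdot>\<^bsub>C\<^esub> p')}"

text \<open>
  Baer sum: with \<open>P\<close> the pull-back of \<open>p\<close> and \<open>p'\<close>, the middle term is the cokernel of the skew
  diagonal \<open>j = (i, -i') : Y \<rightarrow> P\<close>, and \<open>u = (i, 0) : Y \<rightarrow> P\<close> induces the new inclusion of \<open>Y\<close>.
\<close>

definition baer_sum ::
    "('k, 'o, 'm) lincat \<Rightarrow> 'o \<Rightarrow> 'o \<Rightarrow> ('o, 'm) extn set \<Rightarrow> ('o, 'm) extn set \<Rightarrow> ('o, 'm) extn set" where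
  "baer_sum C X Y \<xi> \<xi>' = {(i'', B'', p''). (i'', B'', p'') \<in> extensions C X Y \<and>
     (\<exists>(i, B, p)\<in>\<xi>. \<exists>(i', B', p')\<in>\<xi>'. \<exists>P q q' b. \<exists>j\<in>mor C Y P. \<exists>u\<in>mor C Y P.
        is_pullback C B B' p p' P q q' \<and>
        q \<cdot>\<^bsub>C\<^esub> j = i \<and> q' \<cdot>\<^bsub>C\<^esub> j = \<ominus>\<^bsub>Hom C Y B'\<^esub> i' \<and>
        q \<cdot>\<^bsub>C\<^esub> u = i \<and> q' \<cdot>\<^bsub>C\<^esub> u = \<zero>\<^bsub>Hom C Y B'\<^esub> \<and>
        is_cokernel C Y P j B'' b \<and>
        i'' = b \<cdot>\<^bsub>C\<^esub> u \<and> p'' \<cdot>\<^bsub>C\<^esub> b = p \<cdot>\<^bsub>C\<^esub> q)}"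

definition Ext1 :: "('k, 'o, 'm) lincat \<Rightarrow> 'o \<Rightarrow> 'o \<Rightarrow> ('k, ('o, 'm) extn set) module" where
  "Ext1 C X Y = \<lparr>carrier = extensions C X Y // ext_equiv C X Y,
     monoid.mult = undefined, one = undefined,
     ring.zero = {(i, B, p). (i, B, p) \<in> extensions C X Y \<and> (\<exists>s r. is_biproduct C Y X B i s r p)},
     ring.add = baer_sum C X Y,
     smult = (\<lambda>c. ext_push C X Y (c \<odot>\<^bsub>Hom C Y Y\<^esub> ident C Y))\<rparr>"


record ('o, 'm, 'p, 'n) lfunctor =
  FObj :: "'o \<Rightarrow> 'p"
  FMor :: "'o \<Rightarrow> 'o \<Rightarrow> 'm \<Rightarrow> 'n"

definition linear_endofunctor ::
    "'k ring \<Rightarrow> ('k, 'o, 'm) lincat \<Rightarrow> ('o, 'm, 'o, 'm) lfunctor \<Rightarrow> bool" where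
  "linear_endofunctor k C F \<longleftrightarrow>
     (\<forall>X\<in>Obj C. FObj F X \<in> Obj C \<and> FMor F X X (ident C X) = ident C (FObj F X)) \<and>
     (\<forall>X\<in>Obj C. \<forall>Y\<in>Obj C. FMor F X Y \<in> lin_maps k (Hom C X Y) (Hom C (FObj F X) (FObj F Y))) \<and>
     (\<forall>X\<in>Obj C. \<forall>Y\<in>Obj C. \<forall>Z\<in>Obj C. \<forall>f\<in>mor C X Y. \<forall>g\<in>mor C Y Z.
        FMor F X Z (g \<cdot>\<^bsub>C\<^esub> f) = FMor F Y Z g \<cdot>\<^bsub>C\<^esub> FMor F X Y f)"

definition comp_endofunctor ::
    "('o, 'm, 'o, 'm) lfunctor \<Rightarrow> ('o, 'm, 'o, 'm) lfunctor \<Rightarrow> ('o, 'm, 'o, 'm) lfunctor" where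
  "comp_endofunctor G F = \<lparr>FObj = (\<lambda>X. FObj G (FObj F X)),
     FMor = (\<lambda>X Y f. FMor G (FObj F X) (FObj F Y) (FMor F X Y f))\<rparr>"

definition naturally_iso_to_identity ::
    "('k, 'o, 'm) lincat \<Rightarrow> ('o, 'm, 'o, 'm) lfunctor \<Rightarrow> bool" where
  "naturally_iso_to_identity C F \<longleftrightarrow>
     (\<exists>\<theta>. (\<forall>X\<in>Obj C. is_iso C (FObj F X) X (\<theta> X)) \<and>
          (\<forall>X\<in>Obj C. \<forall>Y\<in>Obj C. \<forall>f\<in>mor C X Y. \<theta> Y \<cdot>\<^bsub>C\<^esub> FMor F X Y f = f \<cdot>\<^bsub>C\<^esub> \<theta> X))"

definition linear_auto_equivalence ::
    "'k ring \<Rightarrow> ('k, 'o, 'm) lincat \<Rightarrow> ('o, 'm, 'o, 'm) lfunctor \<Rightarrow> bool" where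
  "linear_auto_equivalence k C \<tau> \<longleftrightarrow> linear_endofunctor k C \<tau> \<and>
     (\<exists>\<sigma>. linear_endofunctor k C \<sigma> \<and>
        naturally_iso_to_identity C (comp_endofunctor \<sigma> \<tau>) \<and>
        naturally_iso_to_identity C (comp_endofunctor \<tau> \<sigma>))"

text \<open>
  \<open>\<phi> X Y : D Ext\<^sup>1(X, Y) \<rightarrow> Hom(Y, \<tau> X)\<close> is covariant in \<open>X\<close> and contravariant in \<open>Y\<close>; the last two
  conjuncts are naturality in these two arguments.
\<close>

definition has_serre_duality ::
    "'k ring \<Rightarrow> ('k, 'e) module \<Rightarrow> ('k, 'o, 'm) lincat \<Rightarrow> bool" where
  "has_serre_duality k E C \<longleftrightarrow>
     (\<exists>\<tau> \<phi>. linear_auto_equivalence k C \<tau> \<and>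
       (\<forall>X\<in>Obj C. \<forall>Y\<in>Obj C. \<phi> X Y \<in> lin_isos k (dual k E (Ext1 C X Y)) (Hom C Y (FObj \<tau> X))) \<and>
       (\<forall>X\<in>Obj C. \<forall>X'\<in>Obj C. \<forall>Y\<in>Obj C. \<forall>a\<in>mor C X X'. \<forall>l\<in>carrier (dual k E (Ext1 C X Y)).
          \<phi> X' Y (\<lambda>\<xi>\<in>carrier (Ext1 C X' Y). l (ext_pull C X Y a \<xi>)) = FMor \<tau> X X' a \<cdot>\<^bsub>C\<^esub> \<phi> X Y l) \<and>
       (\<forall>X\<in>Obj C. \<forall>Y\<in>Obj C. \<forall>Y'\<in>Obj C. \<forall>b\<in>mor C Y Y'. \<forall>l\<in>carrier (dual k E (Ext1 C X Y')).
          \<phi> X Y (\<lambda>\<xi>\<in>carrier (Ext1 C X Y). l (ext_push C X Y' b \<xi>)) = \<phi> X Y' l \<cdot>\<^bsub>C\<^esub> b))"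


definition im_Hom :: "('k, 'o, 'm) lincat \<Rightarrow> 'o \<Rightarrow> 'o \<Rightarrow> 'm \<Rightarrow> 'm set" where
  "im_Hom C A X \<alpha> = (\<lambda>f. \<alpha> \<cdot>\<^bsub>C\<^esub> f) ` mor C A X"

definition right_determined :: "('k, 'o, 'm) lincat \<Rightarrow> 'o \<Rightarrow> 'o \<Rightarrow> 'm \<Rightarrow> 'o \<Rightarrow> bool" where
  "right_determined C X Y \<alpha> A \<longleftrightarrow>
     (\<forall>T\<in>Obj C. \<forall>t\<in>mor C T Y. im_Hom C A T t \<subseteq> im_Hom C A X \<alpha> \<longrightarrow>
        (\<exists>t'\<in>mor C T X. t = \<alpha> \<cdot>\<^bsub>C\<^esub> t'))"

text \<open>A submodule of \<open>Hom(A, Y)\<close> over \<open>End(A)\<^sup>o\<^sup>p\<close>, which acts by precomposition.\<close>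

definition Gamma_submodule :: "('k, 'o, 'm) lincat \<Rightarrow> 'o \<Rightarrow> 'o \<Rightarrow> 'm set \<Rightarrow> bool" where
  "Gamma_submodule C A Y H \<longleftrightarrow> subgroup H (add_monoid (Hom C A Y)) \<and>
     (\<forall>h\<in>H. \<forall>\<gamma>\<in>mor C A A. h \<cdot>\<^bsub>C\<^esub> \<gamma> \<in> H)"

definition right_represented ::
    "('k, 'o, 'm) lincat \<Rightarrow> 'o \<Rightarrow> 'm set \<Rightarrow> 'o \<Rightarrow> 'o \<Rightarrow> 'm \<Rightarrow> bool" where
  "right_represented C A H X Y \<alpha> \<longleftrightarrow> right_determined C X Y \<alpha> A \<and> H = im_Hom C A X \<alpha>"

definition has_right_determined_morphisms :: "('k, 'o, 'm) lincat \<Rightarrow> bool" where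
  "has_right_determined_morphisms C \<longleftrightarrow>
     (\<forall>Y\<in>Obj C.
        (\<forall>X\<in>Obj C. \<forall>\<alpha>\<in>mor C X Y. \<exists>A\<in>Obj C. right_determined C X Y \<alpha> A) \<and>
        (\<forall>A\<in>Obj C. \<forall>H. Gamma_submodule C A Y H \<longrightarrow>
           (\<exists>X\<in>Obj C. \<exists>\<alpha>\<in>mor C X Y. right_represented C A H X Y \<alpha>)))"


text \<open>Covariant functors to finitely generated modules; contravariant ones live on \<open>op_cat C\<close>.\<close>

definition kmod_functor ::
    "'k ring \<Rightarrow> ('k, 'o, 'm) lincat \<Rightarrow> ('o, 'm, ('k, 'v) module, 'v \<Rightarrow> 'v) lfunctor \<Rightarrow> bool" where
  "kmod_functor k C F \<longleftrightarrow>
     (\<forall>X\<in>Obj C. fg_module k (FObj F X) \<and> (\<forall>x\<in>carrier (FObj F X). FMor F X X (ident C X) x = x)) \<and>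
     (\<forall>X\<in>Obj C. \<forall>Y\<in>Obj C. \<forall>f\<in>mor C X Y. FMor F X Y f \<in> lin_maps k (FObj F X) (FObj F Y)) \<and>
     (\<forall>X\<in>Obj C. \<forall>Y\<in>Obj C. \<forall>Z\<in>Obj C. \<forall>f\<in>mor C X Y. \<forall>g\<in>mor C Y Z. \<forall>x\<in>carrier (FObj F X).
        FMor F X Z (g \<cdot>\<^bsub>C\<^esub> f) x = FMor F Y Z g (FMor F X Y f x)) \<and>
     (\<forall>X\<in>Obj C. \<forall>Y\<in>Obj C. \<forall>f\<in>mor C X Y. \<forall>g\<in>mor C X Y. \<forall>x\<in>carrier (FObj F X).
        FMor F X Y (f \<oplus>\<^bsub>Hom C X Y\<^esub> g) x = FMor F X Y f x \<oplus>\<^bsub>FObj F Y\<^esub> FMor F X Y g x) \<and>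
     (\<forall>X\<in>Obj C. \<forall>Y\<in>Obj C. \<forall>c\<in>carrier k. \<forall>f\<in>mor C X Y. \<forall>x\<in>carrier (FObj F X).
        FMor F X Y (c \<odot>\<^bsub>Hom C X Y\<^esub> f) x = c \<odot>\<^bsub>FObj F Y\<^esub> FMor F X Y f x)"

definition hom_functor ::
    "('k, 'o, 'm) lincat \<Rightarrow> 'o \<Rightarrow> ('o, 'm, ('k, 'm) module, 'm \<Rightarrow> 'm) lfunctor" where
  "hom_functor C X = \<lparr>FObj = Hom C X, FMor = (\<lambda>Y Z f g. f \<cdot>\<^bsub>C\<^esub> g)\<rparr>"

definition nat_transf ::
    "'k ring \<Rightarrow> ('k, 'o, 'm) lincat \<Rightarrow> ('o, 'm, ('k, 'u) module, 'u \<Rightarrow> 'u) lfunctor \<Rightarrow>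
     ('o, 'm, ('k, 'v) module, 'v \<Rightarrow> 'v) lfunctor \<Rightarrow> ('o \<Rightarrow> 'u \<Rightarrow> 'v) \<Rightarrow> bool" where
  "nat_transf k C F G \<eta> \<longleftrightarrow>
     (\<forall>X\<in>Obj C. \<eta> X \<in> lin_maps k (FObj F X) (FObj G X)) \<and>
     (\<forall>X\<in>Obj C. \<forall>Y\<in>Obj C. \<forall>f\<in>mor C X Y. \<forall>x\<in>carrier (FObj F X).
        \<eta> Y (FMor F X Y f x) = FMor G X Y f (\<eta> X x))"

text \<open>\<open>Hom(X, -) \<rightarrow> Hom(Y, -) \<rightarrow> G \<rightarrow> 0\<close> is exact, which is tested objectwise.\<close>

definition finitely_presented ::
    "'k ring \<Rightarrow> ('k, 'o, 'm) lincat \<Rightarrow> ('o, 'm, ('k, 'v) module, 'v \<Rightarrow> 'v) lfunctor \<Rightarrow> bool" where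
  "finitely_presented k C G \<longleftrightarrow>
     (\<exists>X\<in>Obj C. \<exists>Y\<in>Obj C. \<exists>\<eta> \<pi>.
        nat_transf k C (hom_functor C X) (hom_functor C Y) \<eta> \<and>
        nat_transf k C (hom_functor C Y) G \<pi> \<and>
        (\<forall>Z\<in>Obj C. \<eta> Z ` mor C X Z = {g \<in> mor C Y Z. \<pi> Z g = \<zero>\<^bsub>FObj G Z\<^esub>} \<and>
                   \<pi> Z ` mor C Y Z = carrier (FObj G Z)))"

text \<open>For a functor \<open>F\<close> on \<open>op_cat C\<close>, the dual \<open>DF\<close> is a functor on \<open>C\<close>.\<close>

definition dual_functor ::
    "'k ring \<Rightarrow> ('k, 'e) module \<Rightarrow> ('o, 'm, ('k, 'v) module, 'v \<Rightarrow> 'v) lfunctor \<Rightarrow>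
     ('o, 'm, ('k, 'v \<Rightarrow> 'e) module, ('v \<Rightarrow> 'e) \<Rightarrow> ('v \<Rightarrow> 'e)) lfunctor" where
  "dual_functor k E F = \<lparr>FObj = (\<lambda>X. dual k E (FObj F X)),
     FMor = (\<lambda>X Y f l. \<lambda>v\<in>carrier (FObj F Y). l (FMor F Y X f v))\<rparr>"

definition dualizing_variety ::
    "'k ring \<Rightarrow> ('k, 'e) module \<Rightarrow> ('k, 'o, 'm) lincat \<Rightarrow> bool" where
  "dualizing_variety k E C \<longleftrightarrow>
     (\<forall>F :: ('o, 'm, ('k, 'k univ_elt) module, 'k univ_elt \<Rightarrow> 'k univ_elt) lfunctor.
        kmod_functor k (op_cat C) F \<longrightarrow>
        (finitely_presented k (op_cat C) F \<longleftrightarrow> finitely_presented k C (dual_functor k E F)))"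

end

theory Submission
  imports Defs
begin

text \<open>The choice of t rests on a descent: Hom(A, V) is finitely generated over an artinian
  ring, so among the images of Hom(A, T) over all epimorphisms T -> V there is a minimal one, and
  Serre duality lets any nonzero image be cut down further. Two features of the definitions shape
  the rest. \<open>Ext1\<close> is a bare record, and no module law is proved for it or for its
  \<open>dual\<close>. Zero is therefore always reached as a multiple by the scalar 0: the push-out
  along 0 is computed by hand to be the set of split extensions, and homogeneity of a functional
  makes it vanish there. Moreover, \<open>cogenerator_module\<close> and
  \<open>dualizing_variety\<close> range only over modules with elements in
  \<open>'k univ_elt\<close>, so Hom(-, V) cannot be inserted directly. It is first encoded, object
  by object, in that type.\<close>

text \<open>
  Serre duality excludes nonzero projectives in a strong form: for all \<open>A\<close> and \<open>V\<close> there is an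
  epimorphism \<open>t : T \<rightarrow> V\<close> such that every composite \<open>A \<rightarrow> T \<rightarrow> V\<close> vanishes. A morphism \<open>\<alpha>\<close> to \<open>V\<close>
  that is determined by \<open>A\<close> must then factor \<open>t\<close>, so \<open>\<alpha>\<close> is epi. For the last claim, \<open>Hom(-, V)\<close>
  is finitely presented. If \<open>D Hom(-, V)\<close> were generated by its value at some \<open>Y\<close>, every functional
  on \<open>Hom(T, V)\<close> would factor through composition with a morphism \<open>Y \<rightarrow> T\<close> and hence kill the \<open>t\<close>
  obtained for \<open>A = Y\<close>; but a cogenerator separates \<open>t \<noteq> 0\<close> from \<open>0\<close>.
\<close>

section \<open>Finitely generated modules\<close>

locale module_over = module R M
  for R :: "'k ring" (structure) and M :: "('k, 'u) module" (structure)
begin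

text \<open>Coefficients are total functions on \<open>nat\<close>, of which only the first n values
  matter, so that a set of coefficient vectors is literally an element of
  \<open>'k univ_elt\<close>.\<close>

primrec lin_comb :: "(nat \<Rightarrow> 'u) \<Rightarrow> nat \<Rightarrow> (nat \<Rightarrow> 'k) \<Rightarrow> 'u" where
  "lin_comb g 0 a = \<zero>\<^bsub>M\<^esub>"
| "lin_comb g (Suc n) a = lin_comb g n a \<oplus>\<^bsub>M\<^esub> a n \<odot>\<^bsub>M\<^esub> g n"

definition lin_span :: "(nat \<Rightarrow> 'u) \<Rightarrow> nat \<Rightarrow> 'u set" where
  "lin_span g n = lin_comb g n ` (UNIV \<rightarrow> carrier R)"

lemma lin_comb_closed:
  assumes "range g \<subseteq> carrier M" "a \<in> UNIV \<rightarrow> carrier R"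
  shows "lin_comb g n a \<in> carrier M"
  using assms by (induction n) (auto simp: Pi_iff range_subsetD)

lemma lin_comb_add:
  assumes "range g \<subseteq> carrier M" "a \<in> UNIV \<rightarrow> carrier R" "b \<in> UNIV \<rightarrow> carrier R"
  shows "lin_comb g n (\<lambda>i. a i \<oplus> b i) = lin_comb g n a \<oplus>\<^bsub>M\<^esub> lin_comb g n b"
proof (induction n)
  case (Suc n)
  have [simp]: "g n \<in> carrier M" "a n \<in> carrier R" "b n \<in> carrier R"
    "lin_comb g n a \<in> carrier M" "lin_comb g n b \<in> carrier M"
    using assms lin_comb_closed by auto
  show ?case
    by (simp add: Suc smult_l_distr M.a_ac)
qed simp

lemma lin_comb_smult:
  assumes "range g \<subseteq> carrier M" "a \<in> UNIV \<rightarrow> carrier R" "c \<in> carrier R"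
  shows "lin_comb g n (\<lambda>i. c \<otimes> a i) = c \<odot>\<^bsub>M\<^esub> lin_comb g n a"
proof (induction n)
  case 0
  then show ?case using assms by simp
next
  case (Suc n)
  have [simp]: "g n \<in> carrier M" "a n \<in> carrier R" "lin_comb g n a \<in> carrier M"
    using assms lin_comb_closed by auto
  show ?case
    using assms by (simp add: Suc smult_r_distr smult_assoc1)
qed

lemma submoduleI_smult:
  assumes "H \<subseteq> carrier M" "\<zero>\<^bsub>M\<^esub> \<in> H" "\<And>a b. a \<in> H \<Longrightarrow> b \<in> H \<Longrightarrow> a \<oplus>\<^bsub>M\<^esub> b \<in> H"
    "\<And>a x. a \<in> carrier R \<Longrightarrow> x \<in> H \<Longrightarrow> a \<odot>\<^bsub>M\<^esub> x \<in> H"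
  shows "submodule H R M"
proof (rule submoduleI)
  fix x assume x: "x \<in> H"
  then have "\<ominus>\<^bsub>M\<^esub> x = (\<ominus> \<one>) \<odot>\<^bsub>M\<^esub> x"
    using assms(1) by (subst smult_l_minus) auto
  then show "\<ominus>\<^bsub>M\<^esub> x \<in> H" using x assms(4) by simp
qed (use assms in auto)

lemma submodule_Int:
  assumes "submodule H R M" "submodule K R M"
  shows "submodule (H \<inter> K) R M"
  using submoduleE[OF assms(1)] submoduleE[OF assms(2)] assms
  by (intro submoduleI_smult) (auto simp: submodule_def subgroup_def)

lemma zero_in_submodule: "submodule H R M \<Longrightarrow> \<zero>\<^bsub>M\<^esub> \<in> H"
  by (auto simp: submodule_def subgroup_def)

lemma lin_comb_zero:
  assumes "range g \<subseteq> carrier M"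
  shows "lin_comb g n (\<lambda>i. \<zero>) = \<zero>\<^bsub>M\<^esub>"
  using assms by (induction n) (auto simp: range_subsetD)

lemma lin_span_submodule:
  assumes g: "range g \<subseteq> carrier M"
  shows "submodule (lin_span g n) R M"
proof (rule submoduleI_smult)
  show "lin_span g n \<subseteq> carrier M"
    using g lin_comb_closed by (auto simp: lin_span_def)
  show "\<zero>\<^bsub>M\<^esub> \<in> lin_span g n"
    unfolding lin_span_def by (rule image_eqI[where x = "\<lambda>_. \<zero>"]) (auto simp: lin_comb_zero g)
next
  fix x y assume "x \<in> lin_span g n" "y \<in> lin_span g n"
  then obtain a b where "a \<in> UNIV \<rightarrow> carrier R" "b \<in> UNIV \<rightarrow> carrier R"
    "x = lin_comb g n a" "y = lin_comb g n b" by (auto simp: lin_span_def)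
  then show "x \<oplus>\<^bsub>M\<^esub> y \<in> lin_span g n"
    unfolding lin_span_def using g
    by (intro image_eqI[where x = "\<lambda>i. a i \<oplus> b i"]) (auto simp: lin_comb_add)
next
  fix c x assume "c \<in> carrier R" "x \<in> lin_span g n"
  then obtain a where "a \<in> UNIV \<rightarrow> carrier R" "x = lin_comb g n a" "c \<in> carrier R"
    by (auto simp: lin_span_def)
  then show "c \<odot>\<^bsub>M\<^esub> x \<in> lin_span g n"
    unfolding lin_span_def using g
    by (intro image_eqI[where x = "\<lambda>i. c \<otimes> a i"]) (auto simp: lin_comb_smult)
qed

lemma lin_comb_cong: "(\<And>i. i < n \<Longrightarrow> a i = b i) \<Longrightarrow> lin_comb g n a = lin_comb g n b"
  by (induction n) auto

text \<open>The induction on the number of generators runs on this recursion. Overwriting the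
  coefficient vector at n does not disturb the combination of the earlier generators.\<close>

lemma lin_span_Suc:
  "lin_span g (Suc n) = {m \<oplus>\<^bsub>M\<^esub> c \<odot>\<^bsub>M\<^esub> g n |m c. m \<in> lin_span g n \<and> c \<in> carrier R}"
proof (intro equalityI subsetI)
  fix x assume "x \<in> {m \<oplus>\<^bsub>M\<^esub> c \<odot>\<^bsub>M\<^esub> g n |m c. m \<in> lin_span g n \<and> c \<in> carrier R}"
  then obtain a c where *: "a \<in> UNIV \<rightarrow> carrier R" "c \<in> carrier R"
    "x = lin_comb g n a \<oplus>\<^bsub>M\<^esub> c \<odot>\<^bsub>M\<^esub> g n" by (auto simp: lin_span_def)
  moreover have "lin_comb g n (a(n := c)) = lin_comb g n a"
    by (rule lin_comb_cong) auto
  ultimately show "x \<in> lin_span g (Suc n)"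
    unfolding lin_span_def by (intro image_eqI[where x = "a(n := c)"]) auto
qed (auto simp: lin_span_def)

lemma generator_in_lin_span:
  assumes g: "range g \<subseteq> carrier M" and "i < n"
  shows "g i \<in> lin_span g n"
  using \<open>i < n\<close>
proof (induction n)
  case (Suc n)
  show ?case
  proof (cases "i = n")
    case True
    have "g n = \<zero>\<^bsub>M\<^esub> \<oplus>\<^bsub>M\<^esub> \<one> \<odot>\<^bsub>M\<^esub> g n" using g by (simp add: range_subsetD)
    then show ?thesis
      unfolding lin_span_Suc True using zero_in_submodule[OF lin_span_submodule[OF g]] by blast
  next
    case False
    then have i: "g i \<in> lin_span g n" using Suc by simp
    moreover have "g i = g i \<oplus>\<^bsub>M\<^esub> \<zero> \<odot>\<^bsub>M\<^esub> g n" using g by (simp add: range_subsetD)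
    ultimately show ?thesis unfolding lin_span_Suc by blast
  qed
qed simp

section \<open>Descending chains of submodules over an artinian ring\<close>

text \<open>The analogue of leading coefficients in Hilbert's basis theorem: the preimage in R of
  the image of N \<inter> \<open>lin_span g (Suc n)\<close> in the cyclic quotient by
  \<open>lin_span g n\<close>. Generators may satisfy relations, so a coefficient of
  \<open>g n\<close> is not unique and all that occur are collected.\<close>

lemma leading_coeff_ideal:
  assumes g: "range g \<subseteq> carrier M" and N: "submodule N R M"
  shows "ideal {c \<in> carrier R. \<exists>m\<in>lin_span g n. m \<oplus>\<^bsub>M\<^esub> c \<odot>\<^bsub>M\<^esub> g n \<in> N} R" (is "ideal ?I R")
proof (rule idealI)
  note S = lin_span_submodule[OF g, of n]
  note SE = submoduleE[OF S] and NE = submoduleE[OF N]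
  have gn: "g n \<in> carrier M" using g by auto
  have smult: "x \<otimes> c \<in> ?I" if c: "c \<in> ?I" "x \<in> carrier R" for c x
  proof -
    obtain m where m: "m \<in> lin_span g n" "m \<oplus>\<^bsub>M\<^esub> c \<odot>\<^bsub>M\<^esub> g n \<in> N" "c \<in> carrier R" using c by auto
    have "x \<odot>\<^bsub>M\<^esub> (m \<oplus>\<^bsub>M\<^esub> c \<odot>\<^bsub>M\<^esub> g n) = x \<odot>\<^bsub>M\<^esub> m \<oplus>\<^bsub>M\<^esub> (x \<otimes> c) \<odot>\<^bsub>M\<^esub> g n"
      using m SE(1) gn \<open>x \<in> carrier R\<close> by (simp add: smult_r_distr smult_assoc1 subsetD)
    then show ?thesis
      using m SE(4) NE(4) \<open>x \<in> carrier R\<close> by (auto intro!: bexI[of _ "x \<odot>\<^bsub>M\<^esub> m"] simp flip: \<open>_ = _\<close>)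
  qed
  show "ring R" ..
  show "x \<otimes> c \<in> ?I" if "c \<in> ?I" "x \<in> carrier R" for c x using smult that .
  show "c \<otimes> x \<in> ?I" if "c \<in> ?I" "x \<in> carrier R" for c x
    using smult[OF that] that by (simp add: R.m_comm)
  show "subgroup ?I (add_monoid R)"
  proof (rule R.add.subgroupI)
    show "?I \<subseteq> carrier R" by auto
    have "\<zero> \<in> ?I"
      using zero_in_submodule[OF S] zero_in_submodule[OF N] gn by (auto intro!: bexI[of _ "\<zero>\<^bsub>M\<^esub>"])
    then show "?I \<noteq> {}" by blast
    show "\<ominus> c \<in> ?I" if "c \<in> ?I" for c
    proof -
      have "\<ominus> c = (\<ominus> \<one>) \<otimes> c" using that by (simp add: R.l_minus)
      then show ?thesis using smult[OF that, of "\<ominus> \<one>"] by simp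
    qed
    show "c \<oplus> d \<in> ?I" if cd: "c \<in> ?I" "d \<in> ?I" for c d
    proof -
      obtain m where m: "m \<in> lin_span g n" "m \<oplus>\<^bsub>M\<^esub> c \<odot>\<^bsub>M\<^esub> g n \<in> N" "c \<in> carrier R" using cd(1) by auto
      obtain m' where m': "m' \<in> lin_span g n" "m' \<oplus>\<^bsub>M\<^esub> d \<odot>\<^bsub>M\<^esub> g n \<in> N" "d \<in> carrier R" using cd(2) by auto
      have [simp]: "m \<in> carrier M" "m' \<in> carrier M" using m m' SE(1) by auto
      have "(m \<oplus>\<^bsub>M\<^esub> c \<odot>\<^bsub>M\<^esub> g n) \<oplus>\<^bsub>M\<^esub> (m' \<oplus>\<^bsub>M\<^esub> d \<odot>\<^bsub>M\<^esub> g n) = (m \<oplus>\<^bsub>M\<^esub> m') \<oplus>\<^bsub>M\<^esub> (c \<oplus> d) \<odot>\<^bsub>M\<^esub> g n"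
        using m m' gn by (simp add: smult_l_distr M.a_ac)
      then have "(m \<oplus>\<^bsub>M\<^esub> m') \<oplus>\<^bsub>M\<^esub> (c \<oplus> d) \<odot>\<^bsub>M\<^esub> g n \<in> N" using NE(5)[OF m(2) m'(2)] by simp
      then show ?thesis using SE(5)[OF m(1) m'(1)] m m' by auto
    qed
  qed
qed

text \<open>A chain is stationary as soon as its traces on \<open>lin_span g n\<close> and its
  ideals of coefficients at \<open>g n\<close> are, because nested submodules that agree in both
  coincide. The chain is generalised, as the induction hypothesis is applied to the chain of
  traces.\<close>

lemma decreasing_submodules_of_span_stationary:
  assumes art: "artinian_cring R" and g: "range g \<subseteq> carrier M"
    and "\<And>j. submodule (N j) R M" "\<And>j. N (Suc j) \<subseteq> N j" "\<And>j. N j \<subseteq> lin_span g n"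
  shows "\<exists>J. \<forall>j\<ge>J. N j = N J"
  using assms(3-)
proof (induction n arbitrary: N)
  case 0
  have "N j = {\<zero>\<^bsub>M\<^esub>}" for j
    using 0(3)[of j] zero_in_submodule[OF 0(1)[of j]] by (auto simp: lin_span_def)
  then show ?case by simp
next
  case (Suc n)
  note S = lin_span_submodule[OF g, of n]
  note SE = submoduleE[OF S] and NE = submoduleE[OF Suc(2)]
  have anti: "N j \<subseteq> N i" if "i \<le> j" for i j
    using that by (rule lift_Suc_antimono_le[of N, rotated]) (rule Suc(3))
  have gn: "g n \<in> carrier M" using g by auto
  have "\<exists>J. \<forall>j\<ge>J. N j \<inter> lin_span g n = N J \<inter> lin_span g n"
    by (rule Suc.IH) (use Suc(2,3) S submodule_Int in auto)
  then obtain J1 where J1: "\<And>j. j \<ge> J1 \<Longrightarrow> N j \<inter> lin_span g n = N J1 \<inter> lin_span g n" by blast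
  define I where "I j = {c \<in> carrier R. \<exists>m\<in>lin_span g n. m \<oplus>\<^bsub>M\<^esub> c \<odot>\<^bsub>M\<^esub> g n \<in> N j}" for j
  have "(\<forall>j. ideal (I j) R) \<and> (\<forall>j. I (Suc j) \<subseteq> I j)"
    using leading_coeff_ideal[OF g Suc(2)] Suc(3) unfolding I_def by blast
  then obtain J2 where J2: "\<And>j. j \<ge> J2 \<Longrightarrow> I j = I J2"
    using art unfolding artinian_cring_def by meson
  define J where "J = max J1 J2"
  have "N J \<subseteq> N j" if j: "j \<ge> J" for j
  proof
    fix x assume x: "x \<in> N J"
    then obtain m c where m: "m \<in> lin_span g n" "c \<in> carrier R" "x = m \<oplus>\<^bsub>M\<^esub> c \<odot>\<^bsub>M\<^esub> g n"
      using Suc(4)[of J] unfolding lin_span_Suc by blast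
    then have "c \<in> I J" using x unfolding I_def by auto
    then have "c \<in> I j" using J2[of j] J2[of J] j by (simp add: J_def)
    then obtain m' where m': "m' \<in> lin_span g n" "m' \<oplus>\<^bsub>M\<^esub> c \<odot>\<^bsub>M\<^esub> g n \<in> N j"
      unfolding I_def by auto
    let ?y = "m' \<oplus>\<^bsub>M\<^esub> c \<odot>\<^bsub>M\<^esub> g n"
    have [simp]: "m \<in> carrier M" "m' \<in> carrier M" using m m' SE(1) by auto
    \<comment> \<open>Both elements have the coefficient c at \<open>g n\<close>, so their
      difference falls into \<open>lin_span g n\<close>, where the traces of \<open>N J\<close> and
      \<open>N j\<close> agree.\<close>
    have eq: "x \<oplus>\<^bsub>M\<^esub> \<ominus>\<^bsub>M\<^esub> ?y = m \<oplus>\<^bsub>M\<^esub> \<ominus>\<^bsub>M\<^esub> m'"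
      using m(2,3) gn by (simp add: M.minus_add M.a_ac M.r_neg1 M.r_neg2 M.r_neg)
    have "x \<oplus>\<^bsub>M\<^esub> \<ominus>\<^bsub>M\<^esub> ?y \<in> N J"
      using x m'(2) anti[OF j] NE(3,5) by blast
    moreover have "m \<oplus>\<^bsub>M\<^esub> \<ominus>\<^bsub>M\<^esub> m' \<in> lin_span g n" using m m' SE(3,5) by blast
    ultimately have "x \<oplus>\<^bsub>M\<^esub> \<ominus>\<^bsub>M\<^esub> ?y \<in> N J \<inter> lin_span g n" using eq by simp
    then have "x \<oplus>\<^bsub>M\<^esub> \<ominus>\<^bsub>M\<^esub> ?y \<in> N j" using J1[of j] J1[of J] j by (auto simp: J_def)
    then have "(x \<oplus>\<^bsub>M\<^esub> \<ominus>\<^bsub>M\<^esub> ?y) \<oplus>\<^bsub>M\<^esub> ?y \<in> N j" using m' NE(5) by blast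
    moreover have "(x \<oplus>\<^bsub>M\<^esub> \<ominus>\<^bsub>M\<^esub> ?y) \<oplus>\<^bsub>M\<^esub> ?y = x"
      using m(2,3) gn by (simp add: M.a_assoc M.l_neg)
    ultimately show "x \<in> N j" by simp
  qed
  then show ?case using anti by (intro exI[of _ J]) blast
qed

lemma fg_module_lin_span:
  assumes "fg_module R M"
  obtains g n where "range g \<subseteq> carrier M" "lin_span g n = carrier M"
proof -
  obtain S where S: "finite S" "S \<subseteq> carrier M"
    and gen: "\<forall>N. submodule N R M \<and> S \<subseteq> N \<longrightarrow> N = carrier M"
    using assms unfolding fg_module_def by (elim conjE exE) (rule that)
  obtain n :: nat and f where f: "S = f ` {i. i < n}"
    using finite_imp_nat_seg_image_inj_on[OF S(1)] by blast
  \<comment> \<open>Padding with zero keeps the range of the total sequence inside the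
    carrier.\<close>
  define g where "g i = (if i < n then f i else \<zero>\<^bsub>M\<^esub>)" for i
  have g: "range g \<subseteq> carrier M" using S(2) unfolding f g_def by auto
  have "f i \<in> lin_span g n" if "i < n" for i
    using generator_in_lin_span[OF g that] that by (simp add: g_def)
  then have "S \<subseteq> lin_span g n" unfolding f by blast
  then have "lin_span g n = carrier M"
    by (intro gen[rule_format] conjI lin_span_submodule g)
  with g show ?thesis using that by blast
qed

lemma submodule_minimal_exists:
  assumes "artinian_cring R" "fg_module R M" "\<S> \<noteq> {}" "\<And>N. N \<in> \<S> \<Longrightarrow> submodule N R M"
  obtains N where "N \<in> \<S>" "\<And>N'. N' \<in> \<S> \<Longrightarrow> N' \<subseteq> N \<Longrightarrow> N' = N"
proof -
  obtain g n where g: "range g \<subseteq> carrier M" "lin_span g n = carrier M"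
    using fg_module_lin_span[OF assms(2)] .
  have "wf {(N, N'). N \<in> \<S> \<and> N' \<in> \<S> \<and> N \<subset> N'}"
    unfolding wf_iff_no_infinite_down_chain
  proof (rule notI, elim exE)
    fix f assume "\<forall>i. (f (Suc i), f i) \<in> {(N, N'). N \<in> \<S> \<and> N' \<in> \<S> \<and> N \<subset> N'}"
    then have f: "f i \<in> \<S>" "f (Suc i) \<subset> f i" for i by blast+
    have "\<exists>J. \<forall>j\<ge>J. f j = f J"
    proof (rule decreasing_submodules_of_span_stationary[OF assms(1) g(1)])
      show sub: "submodule (f j) R M" for j by (rule assms(4)[OF f(1)])
      show "f (Suc j) \<subseteq> f j" for j using f(2)[of j] by blast
      show "f j \<subseteq> lin_span g n" for j unfolding g(2) by (rule submoduleE(1)[OF sub])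
    qed
    then obtain J where J: "\<forall>j\<ge>J. f j = f J" ..
    have "f (Suc J) = f J" by (rule J[rule_format]) simp
    then show False using f(2)[of J] by blast
  qed
  then show ?thesis
  proof (rule wfE_min'[OF _ assms(3)])
    fix N assume N: "N \<in> \<S>"
      and min: "\<And>N'. (N', N) \<in> {(N, N'). N \<in> \<S> \<and> N' \<in> \<S> \<and> N \<subset> N'} \<Longrightarrow> N' \<notin> \<S>"
    show ?thesis
      by (rule that[OF N]) (use min N in blast)
  qed
qed

text \<open>An element is encoded by the set of all coefficient vectors that represent it.\<close>

lemma fg_module_embeds_in_univ_elt:
  assumes "fg_module R M"
  obtains \<iota> :: "'u \<Rightarrow> 'k univ_elt" where "inj_on \<iota> (carrier M)"
proof -
  obtain g n where g: "range g \<subseteq> carrier M" "lin_span g n = carrier M"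
    using fg_module_lin_span[OF assms] .
  \<comment> \<open>The sets belonging to distinct elements are disjoint, and none is empty because
    the generators span M.\<close>
  have "inj_on (\<lambda>x. {a \<in> UNIV \<rightarrow> carrier R. lin_comb g n a = x}) (carrier M)"
    unfolding g(2)[symmetric] lin_span_def by (auto simp: inj_on_def)
  then show ?thesis using that by blast
qed

end

section \<open>Transport of module structure along an injection\<close>

text \<open>This turns a module on an arbitrary type into an isomorphic one on
  \<open>'k univ_elt\<close>, where the conditions quantifying over modules can be applied.
  Operations decode, compute in M and encode again.\<close>

definition transport_module :: "('u \<Rightarrow> 'v) \<Rightarrow> ('k, 'u) module \<Rightarrow> ('k, 'v) module" where
  "transport_module \<iota> M = \<lparr>carrier = \<iota> ` carrier M,
     monoid.mult = undefined, one = undefined,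
     ring.zero = \<iota> \<zero>\<^bsub>M\<^esub>,
     ring.add = (\<lambda>x y. \<iota> (inv_into (carrier M) \<iota> x \<oplus>\<^bsub>M\<^esub> inv_into (carrier M) \<iota> y)),
     smult = (\<lambda>c x. \<iota> (c \<odot>\<^bsub>M\<^esub> inv_into (carrier M) \<iota> x))\<rparr>"

context
  fixes R :: "'k ring" and M :: "('k, 'u) module" and \<iota> :: "'u \<Rightarrow> 'v"
  assumes M: "module R M" and inj: "inj_on \<iota> (carrier M)"
begin

interpretation module_over R M by (intro module_over.intro M)

lemma transport_module_simps [simp]:
  "carrier (transport_module \<iota> M) = \<iota> ` carrier M"
  "\<zero>\<^bsub>transport_module \<iota> M\<^esub> = \<iota> \<zero>\<^bsub>M\<^esub>"
  "\<lbrakk>x \<in> carrier M; y \<in> carrier M\<rbrakk> \<Longrightarrow> \<iota> x \<oplus>\<^bsub>transport_module \<iota> M\<^esub> \<iota> y = \<iota> (x \<oplus>\<^bsub>M\<^esub> y)"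
  "x \<in> carrier M \<Longrightarrow> c \<odot>\<^bsub>transport_module \<iota> M\<^esub> \<iota> x = \<iota> (c \<odot>\<^bsub>M\<^esub> x)"
  using inj by (simp_all add: transport_module_def)

lemma transport_module_module: "module R (transport_module \<iota> M)"
proof (rule moduleI)
  show "cring R" ..
  show "abelian_group (transport_module \<iota> M)"
  proof (rule abelian_groupI)
    fix x assume "x \<in> carrier (transport_module \<iota> M)"
    then obtain y where "y \<in> carrier M" "x = \<iota> y" by auto
    then show "\<exists>y\<in>carrier (transport_module \<iota> M).
        y \<oplus>\<^bsub>transport_module \<iota> M\<^esub> x = \<zero>\<^bsub>transport_module \<iota> M\<^esub>"
      by (intro bexI[of _ "\<iota> (\<ominus>\<^bsub>M\<^esub> y)"]) (auto simp: M.l_neg)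
  qed (auto simp: M.a_ac)
qed (auto simp: smult_l_distr smult_r_distr smult_assoc1)

lemma transport_module_fg:
  assumes "fg_module R M"
  shows "fg_module R (transport_module \<iota> M)"
proof -
  interpret T: module_over R "transport_module \<iota> M"
    by (intro module_over.intro transport_module_module)
  obtain S where S: "finite S" "S \<subseteq> carrier M"
    and gen: "\<forall>N. submodule N R M \<and> S \<subseteq> N \<longrightarrow> N = carrier M"
    using assms unfolding fg_module_def by (elim conjE exE) (rule that)
  have span: "N = \<iota> ` carrier M" if N: "submodule N R (transport_module \<iota> M)" "\<iota> ` S \<subseteq> N" for N
  proof -
    note NE = T.submoduleE[OF N(1)]
    \<comment> \<open>The generation property of S is known in M only, so the submodule N is pulled
      back there.\<close>
    let ?N = "{x \<in> carrier M. \<iota> x \<in> N}"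
    have "submodule ?N R M"
    proof (rule submoduleI_smult)
      show "x \<oplus>\<^bsub>M\<^esub> y \<in> ?N" if "x \<in> ?N" "y \<in> ?N" for x y
        using NE(5)[of "\<iota> x" "\<iota> y"] that by simp
      show "c \<odot>\<^bsub>M\<^esub> x \<in> ?N" if "c \<in> carrier R" "x \<in> ?N" for c x
        using NE(4)[of c "\<iota> x"] that by simp
    qed (use T.zero_in_submodule[OF N(1)] in auto)
    then have "?N = carrier M" using S(2) N(2) by (intro gen[rule_format] conjI) auto
    then show ?thesis using NE(1) by auto
  qed
  show ?thesis
    unfolding fg_module_def transport_module_simps(1)
  proof (intro conjI exI[of _ "\<iota> ` S"] transport_module_module allI impI)
    show "finite (\<iota> ` S)" "\<iota> ` S \<subseteq> \<iota> ` carrier M" using S by auto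
    show "N = \<iota> ` carrier M" if "submodule N R (transport_module \<iota> M) \<and> \<iota> ` S \<subseteq> N" for N
      using span that by blast
  qed
qed

end

lemma lin_maps_zero:
  assumes "module k M" "module k N" "f \<in> lin_maps k M N"
  shows "f \<zero>\<^bsub>M\<^esub> = \<zero>\<^bsub>N\<^esub>"
proof -
  interpret M: module k M by fact
  interpret N: module k N by fact
  have "f (\<zero>\<^bsub>k\<^esub> \<odot>\<^bsub>M\<^esub> \<zero>\<^bsub>M\<^esub>) = \<zero>\<^bsub>k\<^esub> \<odot>\<^bsub>N\<^esub> f \<zero>\<^bsub>M\<^esub>"
    using assms(3) M.R.zero_closed M.M.zero_closed unfolding lin_maps_def by blast
  moreover have "f \<zero>\<^bsub>M\<^esub> \<in> carrier N"
    using assms(3) by (auto simp: lin_maps_def hom_def)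
  ultimately show ?thesis by simp
qed

text \<open>Test the cogenerator against the inclusion and the zero map of the submodule generated by \<open>x\<close>.\<close>

lemma cogenerator_separates_points:
  fixes M :: "('k, 'k univ_elt) module"
  assumes E: "cogenerator_module k E" and M: "module k M" and x: "x \<in> carrier M" "x \<noteq> \<zero>\<^bsub>M\<^esub>"
  obtains h where "h \<in> lin_maps k M E" "h x \<noteq> \<zero>\<^bsub>E\<^esub>"
proof -
  interpret module_over k M by (intro module_over.intro M)
  interpret E: module k E using E by (simp add: cogenerator_module_def)
  let ?N = "(\<lambda>c. c \<odot>\<^bsub>M\<^esub> x) ` carrier k"
  let ?M = "M\<lparr>carrier := ?N\<rparr>"
  have sub: "submodule ?N k M"
    using x by (intro submoduleI_smult)
      (auto simp flip: smult_l_distr smult_assoc1 intro: image_eqI[where x = "\<zero>\<^bsub>k\<^esub>"])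
  then have N: "module k ?M" using M submodule.submodule_is_module by blast
  have i: "(\<lambda>y. y) \<in> lin_maps k ?M M" "(\<lambda>y. \<zero>\<^bsub>M\<^esub>) \<in> lin_maps k ?M M"
    using x by (auto simp: lin_maps_def hom_def)
  have ne: "\<exists>y\<in>carrier ?M. y \<noteq> \<zero>\<^bsub>M\<^esub>"
    using x by (intro bexI[of _ x]) (auto intro!: image_eqI[of _ _ "\<one>\<^bsub>k\<^esub>"])
  have "\<exists>h\<in>lin_maps k M E. \<exists>y\<in>carrier ?M. h y \<noteq> h \<zero>\<^bsub>M\<^esub>"
    by (rule E[unfolded cogenerator_module_def, THEN conjunct2, rule_format, OF conjI[OF N conjI[OF M conjI[OF i(1) conjI[OF i(2) ne]]]]])
  then obtain h y where h: "h \<in> lin_maps k M E" "y \<in> carrier ?M" "h y \<noteq> h \<zero>\<^bsub>M\<^esub>"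
    by blast
  then obtain c where c: "c \<in> carrier k" "y = c \<odot>\<^bsub>M\<^esub> x" by auto
  have "h \<zero>\<^bsub>M\<^esub> = \<zero>\<^bsub>E\<^esub>"
    by (rule lin_maps_zero[OF M E.module_axioms h(1)])
  \<comment> \<open>The separated element y is a multiple c of x, so \<open>h x\<close> = 0 would
    force \<open>h y\<close> = 0 as well.\<close>
  then have "h x \<noteq> \<zero>\<^bsub>E\<^esub>" using h c x by (auto simp: lin_maps_def)
  with h(1) show ?thesis using that by blast
qed


section \<open>Linear and abelian categories\<close>

context klinear_category
begin

lemma hom_module_over: "\<lbrakk>X \<in> Obj C; Y \<in> Obj C\<rbrakk> \<Longrightarrow> module_over k (Hom C X Y)"
  by (intro module_over.intro hom_module)

lemma hom_abelian_group: "\<lbrakk>X \<in> Obj C; Y \<in> Obj C\<rbrakk> \<Longrightarrow> abelian_group (Hom C X Y)"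
  using hom_module by (auto simp: module_def)

lemma zero_closed: "\<lbrakk>X \<in> Obj C; Y \<in> Obj C\<rbrakk> \<Longrightarrow> \<zero>\<^bsub>Hom C X Y\<^esub> \<in> mor C X Y"
  using hom_abelian_group abelian_group.axioms(1) abelian_monoid.zero_closed by blast

lemma add_closed:
  "\<lbrakk>X \<in> Obj C; Y \<in> Obj C; f \<in> mor C X Y; g \<in> mor C X Y\<rbrakk> \<Longrightarrow> f \<oplus>\<^bsub>Hom C X Y\<^esub> g \<in> mor C X Y"
  using hom_abelian_group abelian_group.axioms(1) abelian_monoid.a_closed by metis

lemma add_zero:
  assumes "X \<in> Obj C" "Y \<in> Obj C" "f \<in> mor C X Y"
  shows "f \<oplus>\<^bsub>Hom C X Y\<^esub> \<zero>\<^bsub>Hom C X Y\<^esub> = f" "\<zero>\<^bsub>Hom C X Y\<^esub> \<oplus>\<^bsub>Hom C X Y\<^esub> f = f"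
proof -
  interpret module k "Hom C X Y" by (rule hom_module) fact+
  show "f \<oplus>\<^bsub>Hom C X Y\<^esub> \<zero>\<^bsub>Hom C X Y\<^esub> = f" "\<zero>\<^bsub>Hom C X Y\<^esub> \<oplus>\<^bsub>Hom C X Y\<^esub> f = f"
    using assms by simp_all
qed

lemma cmp_zero_right:
  assumes "X \<in> Obj C" "Y \<in> Obj C" "Z \<in> Obj C" "g \<in> mor C Y Z"
  shows "g \<cdot> \<zero>\<^bsub>Hom C X Y\<^esub> = \<zero>\<^bsub>Hom C X Z\<^esub>"
proof -
  interpret XY: module k "Hom C X Y" by (rule hom_module) fact+
  interpret XZ: module k "Hom C X Z" by (rule hom_module) fact+
  have "g \<cdot> (\<zero>\<^bsub>k\<^esub> \<odot>\<^bsub>Hom C X Y\<^esub> \<zero>\<^bsub>Hom C X Y\<^esub>) = \<zero>\<^bsub>k\<^esub> \<odot>\<^bsub>Hom C X Z\<^esub> (g \<cdot> \<zero>\<^bsub>Hom C X Y\<^esub>)"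
    using assms by (intro cmp_smult_right) auto
  moreover have "g \<cdot> \<zero>\<^bsub>Hom C X Y\<^esub> \<in> mor C X Z"
    using assms by (intro cmp_closed) auto
  ultimately show ?thesis by simp
qed

lemma cmp_zero_left:
  assumes "X \<in> Obj C" "Y \<in> Obj C" "Z \<in> Obj C" "f \<in> mor C X Y"
  shows "\<zero>\<^bsub>Hom C Y Z\<^esub> \<cdot> f = \<zero>\<^bsub>Hom C X Z\<^esub>"
proof -
  interpret YZ: module k "Hom C Y Z" by (rule hom_module) fact+
  interpret XZ: module k "Hom C X Z" by (rule hom_module) fact+
  have "(\<zero>\<^bsub>k\<^esub> \<odot>\<^bsub>Hom C Y Z\<^esub> \<zero>\<^bsub>Hom C Y Z\<^esub>) \<cdot> f = \<zero>\<^bsub>k\<^esub> \<odot>\<^bsub>Hom C X Z\<^esub> (\<zero>\<^bsub>Hom C Y Z\<^esub> \<cdot> f)"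
    using assms by (intro cmp_smult_left) auto
  moreover have "\<zero>\<^bsub>Hom C Y Z\<^esub> \<cdot> f \<in> mor C X Z"
    using assms by (intro cmp_closed) auto
  ultimately show ?thesis by simp
qed

text \<open>The difference of f and g is delivered as a summand d, so that additivity of composition
  applies to it as it stands.\<close>

lemma diff_exists:
  assumes "X \<in> Obj C" "Y \<in> Obj C" "f \<in> mor C X Y" "g \<in> mor C X Y"
  obtains d where "d \<in> mor C X Y" "f = g \<oplus>\<^bsub>Hom C X Y\<^esub> d"
proof -
  interpret module k "Hom C X Y" by (rule hom_module) fact+
  have "f = g \<oplus>\<^bsub>Hom C X Y\<^esub> (\<ominus>\<^bsub>Hom C X Y\<^esub> g \<oplus>\<^bsub>Hom C X Y\<^esub> f)"
    using assms by (simp add: M.r_neg2)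
  then show ?thesis by (rule that[rotated]) (use assms in simp)
qed

lemma add_eq_self_iff:
  assumes "X \<in> Obj C" "Y \<in> Obj C" "f \<in> mor C X Y" "d \<in> mor C X Y"
  shows "f \<oplus>\<^bsub>Hom C X Y\<^esub> d = f \<longleftrightarrow> d = \<zero>\<^bsub>Hom C X Y\<^esub>"
proof -
  interpret module k "Hom C X Y" by (rule hom_module) fact+
  show ?thesis using assms by simp
qed

lemma is_epiI_zero:
  assumes "X \<in> Obj C" "Y \<in> Obj C" "f \<in> mor C X Y"
    and 0: "\<And>T s. \<lbrakk>T \<in> Obj C; s \<in> mor C Y T; s \<cdot> f = \<zero>\<^bsub>Hom C X T\<^esub>\<rbrakk> \<Longrightarrow> s = \<zero>\<^bsub>Hom C Y T\<^esub>"
  shows "is_epi C X Y f"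
  unfolding is_epi_def
proof (intro conjI ballI impI)
  fix T s t assume T: "T \<in> Obj C" and s: "s \<in> mor C Y T" and t: "t \<in> mor C Y T" and eq: "s \<cdot> f = t \<cdot> f"
  obtain d where d: "d \<in> mor C Y T" "s = t \<oplus>\<^bsub>Hom C Y T\<^esub> d"
    using diff_exists[OF _ T s t] assms by blast
  then have "t \<cdot> f \<oplus>\<^bsub>Hom C X T\<^esub> d \<cdot> f = t \<cdot> f"
    using eq cmp_add_left assms T t by metis
  then have "d \<cdot> f = \<zero>\<^bsub>Hom C X T\<^esub>"
    using add_eq_self_iff cmp_closed assms T t d by metis
  then show "s = t" using 0 T d t add_zero assms by metis
qed fact

lemma is_epi_cancel:
  "\<lbrakk>is_epi C X Y f; T \<in> Obj C; s \<in> mor C Y T; t \<in> mor C Y T; s \<cdot> f = t \<cdot> f\<rbrakk> \<Longrightarrow> s = t"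
  unfolding is_epi_def by blast

lemma is_epi_cancel_zero:
  assumes "is_epi C X Y f" "X \<in> Obj C" "Y \<in> Obj C" "T \<in> Obj C" "s \<in> mor C Y T" "s \<cdot> f = \<zero>\<^bsub>Hom C X T\<^esub>"
  shows "s = \<zero>\<^bsub>Hom C Y T\<^esub>"
  using assms is_epi_cancel[OF assms(1), of T s "\<zero>\<^bsub>Hom C Y T\<^esub>"] cmp_zero_left[of X Y T f] zero_closed
  by (simp add: is_epi_def)

lemma is_epi_ident: "X \<in> Obj C \<Longrightarrow> is_epi C X X (ident C X)"
  unfolding is_epi_def using ident_closed cmp_ident by metis

lemma is_epi_cmp:
  assumes "X \<in> Obj C" "Y \<in> Obj C" "Z \<in> Obj C" "is_epi C X Y f" "is_epi C Y Z g"
  shows "is_epi C X Z (g \<cdot> f)"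
  unfolding is_epi_def
proof (intro conjI ballI impI)
  have f: "f \<in> mor C X Y" and g: "g \<in> mor C Y Z" using assms by (auto simp: is_epi_def)
  then show "g \<cdot> f \<in> mor C X Z" using assms cmp_closed by blast
  fix T s t assume st: "T \<in> Obj C" "s \<in> mor C Z T" "t \<in> mor C Z T" "s \<cdot> (g \<cdot> f) = t \<cdot> (g \<cdot> f)"
  then have eq: "(s \<cdot> g) \<cdot> f = (t \<cdot> g) \<cdot> f" using assms f g cmp_assoc by metis
  have sg: "s \<cdot> g \<in> mor C Y T" "t \<cdot> g \<in> mor C Y T" using assms st g cmp_closed by blast+
  have "s \<cdot> g = t \<cdot> g" by (rule is_epi_cancel[OF assms(4) st(1) sg eq])
  then show "s = t" by (rule is_epi_cancel[OF assms(5) st(1-3)])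
qed

section \<open>Kernels, cokernels and common refinements of epimorphisms\<close>

lemma kernel_cancel:
  assumes "is_kernel C X Y f K j" "X \<in> Obj C" "Y \<in> Obj C" "f \<in> mor C X Y"
    and "T \<in> Obj C" "s \<in> mor C T K" "t \<in> mor C T K" "j \<cdot> s = j \<cdot> t"
  shows "s = t"
proof -
  have K: "K \<in> Obj C" "j \<in> mor C K X" "f \<cdot> j = \<zero>\<^bsub>Hom C K Y\<^esub>"
    using assms(1) by (auto simp: is_kernel_def)
  have "f \<cdot> (j \<cdot> s) = \<zero>\<^bsub>Hom C T Y\<^esub>"
    using assms K cmp_assoc[of T K X Y s j f] cmp_zero_left[of T K Y s] by simp
  moreover have "j \<cdot> s \<in> mor C T X" using assms K cmp_closed by blast
  ultimately show ?thesis using assms unfolding is_kernel_def by metis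
qed

lemma cokernel_is_epi:
  assumes "is_cokernel C X Y f Q q" "X \<in> Obj C" "Y \<in> Obj C" "f \<in> mor C X Y"
  shows "is_epi C Y Q q"
proof -
  have Q: "Q \<in> Obj C" "q \<in> mor C Y Q" "q \<cdot> f = \<zero>\<^bsub>Hom C X Q\<^esub>"
    using assms(1) by (auto simp: is_cokernel_def)
  have "s = t" if st: "T \<in> Obj C" "s \<in> mor C Q T" "t \<in> mor C Q T" "s \<cdot> q = t \<cdot> q" for T s t
  proof -
    have "(s \<cdot> q) \<cdot> f = \<zero>\<^bsub>Hom C X T\<^esub>"
      using assms Q st cmp_assoc[of X Y Q T f q s] cmp_zero_right[of X Q T s] by simp
    moreover have "s \<cdot> q \<in> mor C Y T" using assms Q st cmp_closed by blast
    ultimately show ?thesis using assms(1) st unfolding is_cokernel_def by metis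
  qed
  then show ?thesis using Q unfolding is_epi_def by blast
qed

text \<open>Exactness of Hom(T, K) -> Hom(T, X) -> Hom(T, Y) in the middle, in the form in which
  retractions of extensions are extracted from it.\<close>

lemma kernel_diff:
  assumes "is_kernel C X Y f K j" "X \<in> Obj C" "Y \<in> Obj C" "f \<in> mor C X Y"
    and T: "T \<in> Obj C" "s \<in> mor C T X" "t \<in> mor C T X" "f \<cdot> s = f \<cdot> t"
  obtains r where "r \<in> mor C T K" "s = t \<oplus>\<^bsub>Hom C T X\<^esub> j \<cdot> r"
proof -
  obtain d where d: "d \<in> mor C T X" "s = t \<oplus>\<^bsub>Hom C T X\<^esub> d"
    using diff_exists T assms by blast
  then have "f \<cdot> t \<oplus>\<^bsub>Hom C T Y\<^esub> f \<cdot> d = f \<cdot> t"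
    using T cmp_add_right assms by metis
  then have "f \<cdot> d = \<zero>\<^bsub>Hom C T Y\<^esub>"
    using add_eq_self_iff cmp_closed assms T d by metis
  then show ?thesis using that d assms unfolding is_kernel_def by metis
qed

lemma cokernel_diff:
  assumes "is_cokernel C X Y f Q q" "X \<in> Obj C" "Y \<in> Obj C" "f \<in> mor C X Y"
    and T: "T \<in> Obj C" "s \<in> mor C Y T" "t \<in> mor C Y T" "s \<cdot> f = t \<cdot> f"
  obtains r where "r \<in> mor C Q T" "s = t \<oplus>\<^bsub>Hom C Y T\<^esub> r \<cdot> q"
proof -
  obtain d where d: "d \<in> mor C Y T" "s = t \<oplus>\<^bsub>Hom C Y T\<^esub> d"
    using diff_exists T assms by blast
  then have "t \<cdot> f \<oplus>\<^bsub>Hom C X T\<^esub> d \<cdot> f = t \<cdot> f"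
    using T cmp_add_left assms by metis
  then have "d \<cdot> f = \<zero>\<^bsub>Hom C X T\<^esub>"
    using add_eq_self_iff cmp_closed assms T d by metis
  then show ?thesis using that d assms unfolding is_cokernel_def by metis
qed

text \<open>Makes the descending chain condition of the k-module Hom(A, V) applicable to these
  images.\<close>

lemma im_Hom_submodule:
  assumes "A \<in> Obj C" "T \<in> Obj C" "V \<in> Obj C" "t \<in> mor C T V"
  shows "submodule (im_Hom C A T t) k (Hom C A V)"
proof -
  interpret AV: module_over k "Hom C A V" by (rule hom_module_over) fact+
  interpret AT: module_over k "Hom C A T" by (rule hom_module_over) fact+
  show ?thesis
  proof (rule AV.submoduleI_smult)
    show "im_Hom C A T t \<subseteq> mor C A V"
      using assms cmp_closed by (auto simp: im_Hom_def)
    show "\<zero>\<^bsub>Hom C A V\<^esub> \<in> im_Hom C A T t"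
      unfolding im_Hom_def using assms
      by (intro image_eqI[where x = "\<zero>\<^bsub>Hom C A T\<^esub>"]) (auto simp: cmp_zero_right)
  next
    fix x y assume "x \<in> im_Hom C A T t" "y \<in> im_Hom C A T t"
    then obtain f g where "f \<in> mor C A T" "g \<in> mor C A T" "x = t \<cdot> f" "y = t \<cdot> g"
      by (auto simp: im_Hom_def)
    then show "x \<oplus>\<^bsub>Hom C A V\<^esub> y \<in> im_Hom C A T t"
      unfolding im_Hom_def using assms
      by (intro image_eqI[where x = "f \<oplus>\<^bsub>Hom C A T\<^esub> g"]) (auto simp: cmp_add_right)
  next
    fix c x assume "c \<in> carrier k" "x \<in> im_Hom C A T t"
    then obtain f where "f \<in> mor C A T" "x = t \<cdot> f" "c \<in> carrier k"
      by (auto simp: im_Hom_def)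
    then show "c \<odot>\<^bsub>Hom C A V\<^esub> x \<in> im_Hom C A T t"
      unfolding im_Hom_def using assms
      by (intro image_eqI[where x = "c \<odot>\<^bsub>Hom C A T\<^esub> f"]) (auto simp: cmp_smult_right)
  qed
qed

text \<open>
  The object \<open>P\<close> is the pull-back, the kernel of \<open>d = p \<circ> p1 - t \<circ> p2 : B \<oplus> T \<rightarrow> V\<close>. As \<open>d\<close> is
  epi, it is the cokernel of \<open>P \<rightarrow> B \<oplus> T\<close>. So a morphism \<open>s\<close> killed by \<open>P \<rightarrow> T\<close> has \<open>s \<circ> p2 = u \<circ> d\<close>
  for some \<open>u\<close>, and restricting to \<open>B\<close> yields \<open>u \<circ> p = 0\<close>.
\<close>

lemma epis_have_common_refinement:
  assumes ab: "abelian_category k C"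
    and O: "B \<in> Obj C" "T \<in> Obj C" "V \<in> Obj C"
    and p: "is_epi C B V p" and t: "is_epi C T V t"
  obtains P q q' where "P \<in> Obj C" "q \<in> mor C P B" "q' \<in> mor C P T" "p \<cdot> q = t \<cdot> q'" "is_epi C P V (t \<cdot> q')"
proof -
  have pm: "p \<in> mor C B V" and tm: "t \<in> mor C T V" using p t by (auto simp: is_epi_def)
  obtain S i1 i2 p1 p2 where "is_biproduct C B T S i1 i2 p1 p2"
    using ab O unfolding abelian_category_def by metis
  then have S: "S \<in> Obj C" "i1 \<in> mor C B S" "i2 \<in> mor C T S" "p1 \<in> mor C S B" "p2 \<in> mor C S T"
    "p1 \<cdot> i1 = ident C B" "p2 \<cdot> i2 = ident C T" "p2 \<cdot> i1 = \<zero>\<^bsub>Hom C B T\<^esub>"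
    by (auto simp: is_biproduct_def)
  have pp1: "p \<cdot> p1 \<in> mor C S V" and tp2: "t \<cdot> p2 \<in> mor C S V"
    using S O pm tm cmp_closed by blast+
  obtain d where d: "d \<in> mor C S V" "p \<cdot> p1 = t \<cdot> p2 \<oplus>\<^bsub>Hom C S V\<^esub> d"
    using diff_exists S O pp1 tp2 by metis
  \<comment> \<open>On the summand B the second term of d vanishes, so d extends p and inherits from
    it the property of being epi.\<close>
  have di1: "d \<cdot> i1 = p"
  proof -
    have "p = (p \<cdot> p1) \<cdot> i1"
      using cmp_assoc[of B S B V i1 p1 p] cmp_ident S O pm by simp
    also have "\<dots> = (t \<cdot> p2) \<cdot> i1 \<oplus>\<^bsub>Hom C B V\<^esub> d \<cdot> i1"
      unfolding d(2) using S O d tp2 by (intro cmp_add_left) auto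
    also have "(t \<cdot> p2) \<cdot> i1 = \<zero>\<^bsub>Hom C B V\<^esub>"
      using cmp_assoc[of B S T V i1 p2 t] cmp_zero_right[of B T V t] S O tm by simp
    also have "\<zero>\<^bsub>Hom C B V\<^esub> \<oplus>\<^bsub>Hom C B V\<^esub> d \<cdot> i1 = d \<cdot> i1"
      using S O d cmp_closed add_zero by metis
    finally show ?thesis ..
  qed
  have d_epi: "is_epi C S V d"
  proof (rule is_epiI_zero)
    fix W s assume s: "W \<in> Obj C" "s \<in> mor C V W" "s \<cdot> d = \<zero>\<^bsub>Hom C S W\<^esub>"
    then have "s \<cdot> p = \<zero>\<^bsub>Hom C B W\<^esub>"
      using cmp_assoc[of B S V W i1 d s] cmp_zero_left[of B S W i1] S O d di1 by simp
    then show "s = \<zero>\<^bsub>Hom C V W\<^esub>" using is_epi_cancel_zero p s O by blast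
  qed (use S O d in auto)
  obtain Z z where Z: "Z \<in> Obj C" "z \<in> mor C Z S" "is_cokernel C Z S z V d"
    using ab d_epi S O unfolding abelian_category_def by metis
  obtain P j where ker: "is_kernel C S V d P j"
    using ab d S O unfolding abelian_category_def by metis
  then have P: "P \<in> Obj C" "j \<in> mor C P S" "d \<cdot> j = \<zero>\<^bsub>Hom C P V\<^esub>"
    by (auto simp: is_kernel_def)
  have p1j: "p1 \<cdot> j \<in> mor C P B" and p2j: "p2 \<cdot> j \<in> mor C P T"
    using P S O cmp_closed by blast+
  have eq: "p \<cdot> (p1 \<cdot> j) = t \<cdot> (p2 \<cdot> j)"
  proof -
    have "p \<cdot> (p1 \<cdot> j) = (p \<cdot> p1) \<cdot> j" using P S O pm by (intro cmp_assoc) auto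
    also have "\<dots> = (t \<cdot> p2) \<cdot> j \<oplus>\<^bsub>Hom C P V\<^esub> d \<cdot> j"
      unfolding d(2) using S O P d tp2 by (intro cmp_add_left) auto
    also have "\<dots> = (t \<cdot> p2) \<cdot> j"
      unfolding P(3) using S O P tp2 cmp_closed by (intro add_zero) auto
    also have "\<dots> = t \<cdot> (p2 \<cdot> j)" using P S O tm by (intro cmp_assoc[symmetric]) auto
    finally show ?thesis .
  qed
  have "is_epi C P T (p2 \<cdot> j)"
  proof (rule is_epiI_zero)
    fix W s assume s: "W \<in> Obj C" "s \<in> mor C T W" "s \<cdot> (p2 \<cdot> j) = \<zero>\<^bsub>Hom C P W\<^esub>"
    have sp2: "s \<cdot> p2 \<in> mor C S W" using s S O cmp_closed by blast
    \<comment> \<open>The epimorphism d is the cokernel of some z, which factors through the kernel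
      j. What kills j thus kills z and factors through d, so d is also the cokernel of its own
      kernel.\<close>
    have "d \<cdot> z = \<zero>\<^bsub>Hom C Z V\<^esub>" using Z by (auto simp: is_cokernel_def)
    then obtain z' where z': "z' \<in> mor C Z P" "j \<cdot> z' = z"
      using ker Z unfolding is_kernel_def by metis
    have "(s \<cdot> p2) \<cdot> z = ((s \<cdot> p2) \<cdot> j) \<cdot> z'"
      using z' Z P S O s sp2 cmp_assoc[of Z P S W z' j "s \<cdot> p2"] by simp
    also have "(s \<cdot> p2) \<cdot> j = \<zero>\<^bsub>Hom C P W\<^esub>"
      using s P S O cmp_assoc[of P S T W j p2 s] by simp
    also have "\<zero>\<^bsub>Hom C P W\<^esub> \<cdot> z' = \<zero>\<^bsub>Hom C Z W\<^esub>"
      using z' Z P s by (intro cmp_zero_left) auto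
    finally obtain u where u: "u \<in> mor C V W" "u \<cdot> d = s \<cdot> p2"
      using Z(3) s(1) sp2 unfolding is_cokernel_def by metis
    have "u \<cdot> p = (s \<cdot> p2) \<cdot> i1"
      using u d S O s di1 cmp_assoc[of B S V W i1 d u] by simp
    also have "\<dots> = \<zero>\<^bsub>Hom C B W\<^esub>"
      using S O s cmp_assoc[of B S T W i1 p2 s] cmp_zero_right[of B T W s] by simp
    finally have "u = \<zero>\<^bsub>Hom C V W\<^esub>" using is_epi_cancel_zero p s O u by blast
    then have "s \<cdot> p2 = \<zero>\<^bsub>Hom C S W\<^esub>" using u d S O s cmp_zero_left by metis
    then have "s \<cdot> (p2 \<cdot> i2) = \<zero>\<^bsub>Hom C T W\<^esub>"
      using S O s cmp_assoc[of T S T W i2 p2 s] cmp_zero_left[of T S W i2] by simp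
    then show "s = \<zero>\<^bsub>Hom C T W\<^esub>" using S O s cmp_ident by simp
  qed (use P S O p2j in auto)
  then have "is_epi C P V (t \<cdot> (p2 \<cdot> j))" using is_epi_cmp t P O by blast
  with P p1j p2j eq show ?thesis using that by blast
qed

end


section \<open>Split extensions and Serre duality\<close>

context klinear_category
begin

lemma extensionsD:
  assumes "(i, B, p) \<in> extensions C X Y"
  shows "B \<in> Obj C" "i \<in> mor C Y B" "p \<in> mor C B X" "is_kernel C B X p Y i" "is_cokernel C Y B i X p"
    "p \<cdot> i = \<zero>\<^bsub>Hom C Y X\<^esub>"
  using assms by (auto simp: extensions_def is_kernel_def)

text \<open>The splitting lemma. Given r, the endomorphism 1 - i r of B kills i and hence factors
  through p; the factor is a section because p is epi. The converse is dual. Both forms matter: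
  pulling back produces retractions, pushing out along 0 produces sections.\<close>

lemma retraction_iff_section:
  assumes e: "(i, B, p) \<in> extensions C X Y" and O: "X \<in> Obj C" "Y \<in> Obj C"
  shows "(\<exists>r\<in>mor C B Y. r \<cdot> i = ident C Y) \<longleftrightarrow> (\<exists>s\<in>mor C X B. p \<cdot> s = ident C X)"
proof
  note E = extensionsD[OF e]
  assume "\<exists>r\<in>mor C B Y. r \<cdot> i = ident C Y"
  then obtain r where r: "r \<in> mor C B Y" "r \<cdot> i = ident C Y" ..
  have ir: "i \<cdot> r \<in> mor C B B" using E O r cmp_closed by blast
  have "ident C B \<cdot> i = (i \<cdot> r) \<cdot> i"
    using E O r cmp_assoc[of Y B Y B i r i] cmp_ident ident_cmp by simp
  then obtain s where s: "s \<in> mor C X B" "ident C B = i \<cdot> r \<oplus>\<^bsub>Hom C B B\<^esub> s \<cdot> p"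
    using cokernel_diff[OF E(5) O(2) E(1,2) E(1) ident_closed[OF E(1)] ir] by blast
  have sp: "s \<cdot> p \<in> mor C B B" using E O s cmp_closed by blast
  have ps: "p \<cdot> s \<in> mor C X X" using E O s cmp_closed by blast
  have "p = p \<cdot> ident C B" using E O cmp_ident by simp
  also have "\<dots> = p \<cdot> (i \<cdot> r) \<oplus>\<^bsub>Hom C B X\<^esub> p \<cdot> (s \<cdot> p)"
    unfolding s(2) using E O ir sp by (intro cmp_add_right) auto
  also have "p \<cdot> (i \<cdot> r) = \<zero>\<^bsub>Hom C B X\<^esub>"
    using E O r cmp_assoc[of B Y B X r i p] cmp_zero_left[of B Y X r] by simp
  also have "p \<cdot> (s \<cdot> p) = (p \<cdot> s) \<cdot> p" using E O s by (intro cmp_assoc) auto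
  also have "\<zero>\<^bsub>Hom C B X\<^esub> \<oplus>\<^bsub>Hom C B X\<^esub> (p \<cdot> s) \<cdot> p = (p \<cdot> s) \<cdot> p"
    using E O ps cmp_closed by (intro add_zero) blast+
  finally have "(p \<cdot> s) \<cdot> p = ident C X \<cdot> p" using ident_cmp E O by simp
  then have "p \<cdot> s = ident C X"
    by (rule is_epi_cancel[OF cokernel_is_epi[OF E(5) O(2) E(1,2)] O(1) ps ident_closed[OF O(1)]])
  with s show "\<exists>s\<in>mor C X B. p \<cdot> s = ident C X" by blast
next
  note E = extensionsD[OF e]
  assume "\<exists>s\<in>mor C X B. p \<cdot> s = ident C X"
  then obtain s where s: "s \<in> mor C X B" "p \<cdot> s = ident C X" ..
  have sp: "s \<cdot> p \<in> mor C B B" using E O s cmp_closed by blast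
  have "p \<cdot> ident C B = p \<cdot> (s \<cdot> p)"
    using E O s cmp_assoc[of B X B X p s p] cmp_ident ident_cmp by simp
  then obtain r where r: "r \<in> mor C B Y" "ident C B = s \<cdot> p \<oplus>\<^bsub>Hom C B B\<^esub> i \<cdot> r"
    using kernel_diff[OF E(4) E(1) O(1) E(3) E(1) ident_closed[OF E(1)] sp] by blast
  have ir: "i \<cdot> r \<in> mor C B B" using E O r cmp_closed by blast
  have ri: "r \<cdot> i \<in> mor C Y Y" using E O r cmp_closed by blast
  have "i = ident C B \<cdot> i" using E O ident_cmp by simp
  also have "\<dots> = (s \<cdot> p) \<cdot> i \<oplus>\<^bsub>Hom C Y B\<^esub> (i \<cdot> r) \<cdot> i"
    unfolding r(2) using E O ir sp by (intro cmp_add_left) auto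
  also have "(s \<cdot> p) \<cdot> i = \<zero>\<^bsub>Hom C Y B\<^esub>"
    using E O s cmp_assoc[of Y B X B i p s] cmp_zero_right[of Y X B s] by simp
  also have "(i \<cdot> r) \<cdot> i = i \<cdot> (r \<cdot> i)" using E O r by (intro cmp_assoc[symmetric]) auto
  also have "\<zero>\<^bsub>Hom C Y B\<^esub> \<oplus>\<^bsub>Hom C Y B\<^esub> i \<cdot> (r \<cdot> i) = i \<cdot> (r \<cdot> i)"
    using E O ri cmp_closed by (intro add_zero) blast+
  finally have "i \<cdot> (r \<cdot> i) = i \<cdot> ident C Y" using cmp_ident E O by simp
  then have "r \<cdot> i = ident C Y"
    by (rule kernel_cancel[OF E(4) E(1) O(1) E(3) O(2) ri ident_closed[OF O(2)]])
  with r show "\<exists>r\<in>mor C B Y. r \<cdot> i = ident C Y" by blast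
qed

section \<open>Pull-backs and push-outs that split\<close>

text \<open>The common value in which a pull-back along a liftable morphism and a push-out along 0
  meet. It is kept as a plain set of triples, to be compared with \<open>ext_pull\<close> and
  \<open>ext_push\<close> by extensionality.\<close>

definition split_extensions :: "'o \<Rightarrow> 'o \<Rightarrow> ('o, 'm) extn set" where
  "split_extensions X Y = {(i, B, p) \<in> extensions C X Y. \<exists>s\<in>mor C X B. p \<cdot> s = ident C X}"

text \<open>If f = p g, then b - g p' is killed by p and so equals i r for some r. Composing with i'
  gives i r i' = i, and r is a retraction because i is mono. Conversely, a retraction r yields b = g
  p' + i r.\<close>

lemma ext_pull_eq_split_extensions:
  assumes O: "A \<in> Obj C" "V \<in> Obj C" "Y \<in> Obj C"
    and \<xi>: "\<xi> \<subseteq> extensions C V Y" "\<xi> \<noteq> {}"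
    and factors: "\<And>i B p. (i, B, p) \<in> \<xi> \<Longrightarrow> \<exists>g\<in>mor C A B. f = p \<cdot> g"
  shows "ext_pull C A Y f \<xi> = split_extensions A Y"
proof (intro equalityI subsetI)
  fix x assume "x \<in> ext_pull C A Y f \<xi>"
  then obtain i' B' p' i B p b where x: "x = (i', B', p')" and e': "(i', B', p') \<in> extensions C A Y"
    and mem: "(i, B, p) \<in> \<xi>" and b: "b \<in> mor C B' B" "b \<cdot> i' = i" "p \<cdot> b = f \<cdot> p'"
    unfolding ext_pull_def by blast
  have e: "(i, B, p) \<in> extensions C V Y" using mem \<xi> by blast
  note E = extensionsD[OF e] and E' = extensionsD[OF e']
  obtain g where g: "g \<in> mor C A B" "f = p \<cdot> g" using factors[OF mem] by blast
  have gp': "g \<cdot> p' \<in> mor C B' B" using g E E' O cmp_closed by blast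
  have "p \<cdot> b = p \<cdot> (g \<cdot> p')" using b g E E' O cmp_assoc[of B' A B V p' g p] by simp
  then obtain r where r: "r \<in> mor C B' Y" "b = g \<cdot> p' \<oplus>\<^bsub>Hom C B' B\<^esub> i \<cdot> r"
    using kernel_diff[OF E(4) E(1) O(2) E(3) E'(1) b(1) gp'] by blast
  have ir: "i \<cdot> r \<in> mor C B' B" using E E' O r cmp_closed by blast
  have ri: "r \<cdot> i' \<in> mor C Y Y" using E E' O r cmp_closed by blast
  have "i = b \<cdot> i'" using b by simp
  also have "\<dots> = (g \<cdot> p') \<cdot> i' \<oplus>\<^bsub>Hom C Y B\<^esub> (i \<cdot> r) \<cdot> i'"
    unfolding r(2) using E E' O ir gp' by (intro cmp_add_left) auto
  also have "(g \<cdot> p') \<cdot> i' = \<zero>\<^bsub>Hom C Y B\<^esub>"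
    using E E' O g cmp_assoc[of Y B' A B i' p' g] cmp_zero_right[of Y A B g] by simp
  also have "(i \<cdot> r) \<cdot> i' = i \<cdot> (r \<cdot> i')" using E E' O r by (intro cmp_assoc[symmetric]) auto
  also have "\<zero>\<^bsub>Hom C Y B\<^esub> \<oplus>\<^bsub>Hom C Y B\<^esub> i \<cdot> (r \<cdot> i') = i \<cdot> (r \<cdot> i')"
    using E O ri cmp_closed by (intro add_zero) blast+
  finally have "i \<cdot> (r \<cdot> i') = i \<cdot> ident C Y" using cmp_ident E O by simp
  then have "r \<cdot> i' = ident C Y"
    by (rule kernel_cancel[OF E(4) E(1) O(2) E(3) O(3) ri ident_closed[OF O(3)]])
  then show "x \<in> split_extensions A Y"
    unfolding x split_extensions_def using e' retraction_iff_section[OF e' O(1,3)] r(1) by blast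
next
  fix x assume "x \<in> split_extensions A Y"
  then obtain i' B' p' where x: "x = (i', B', p')" and e': "(i', B', p') \<in> extensions C A Y"
    and "\<exists>s\<in>mor C A B'. p' \<cdot> s = ident C A"
    unfolding split_extensions_def by blast
  then obtain r where r: "r \<in> mor C B' Y" "r \<cdot> i' = ident C Y"
    using retraction_iff_section[OF e' O(1,3)] by blast
  obtain i B p where mem: "(i, B, p) \<in> \<xi>" using \<xi>(2) by auto
  then have e: "(i, B, p) \<in> extensions C V Y" using \<xi> by blast
  note E = extensionsD[OF e] and E' = extensionsD[OF e']
  obtain g where g: "g \<in> mor C A B" "f = p \<cdot> g" using factors[OF mem] by blast
  have gp': "g \<cdot> p' \<in> mor C B' B" and ir: "i \<cdot> r \<in> mor C B' B"
    using g r E E' O cmp_closed by blast+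
  let ?b = "g \<cdot> p' \<oplus>\<^bsub>Hom C B' B\<^esub> i \<cdot> r"
  have "?b \<cdot> i' = (g \<cdot> p') \<cdot> i' \<oplus>\<^bsub>Hom C Y B\<^esub> (i \<cdot> r) \<cdot> i'"
    using E E' O ir gp' by (intro cmp_add_left) auto
  also have "(g \<cdot> p') \<cdot> i' = \<zero>\<^bsub>Hom C Y B\<^esub>"
    using E E' O g cmp_assoc[of Y B' A B i' p' g] cmp_zero_right[of Y A B g] by simp
  also have "(i \<cdot> r) \<cdot> i' = i"
    using E E' O r cmp_assoc[of Y B' Y B i' r i] cmp_ident by simp
  also have "\<zero>\<^bsub>Hom C Y B\<^esub> \<oplus>\<^bsub>Hom C Y B\<^esub> i = i"
    using E O by (intro add_zero) auto
  finally have bi: "?b \<cdot> i' = i" .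
  have "p \<cdot> ?b = p \<cdot> (g \<cdot> p') \<oplus>\<^bsub>Hom C B' V\<^esub> p \<cdot> (i \<cdot> r)"
    using E E' O ir gp' by (intro cmp_add_right) auto
  also have "p \<cdot> (i \<cdot> r) = \<zero>\<^bsub>Hom C B' V\<^esub>"
    using E E' O r cmp_assoc[of B' Y B V r i p] cmp_zero_left[of B' Y V r] by simp
  also have "p \<cdot> (g \<cdot> p') \<oplus>\<^bsub>Hom C B' V\<^esub> \<zero>\<^bsub>Hom C B' V\<^esub> = p \<cdot> (g \<cdot> p')"
    using E E' O gp' cmp_closed by (intro add_zero) blast+
  also have "\<dots> = f \<cdot> p'" unfolding g(2) using E E' O g by (intro cmp_assoc) auto
  finally have pb: "p \<cdot> ?b = f \<cdot> p'" .
  have "?b \<in> mor C B' B" using E E' O gp' ir by (intro add_closed) auto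
  with bi pb mem e' show "x \<in> ext_pull C A Y f \<xi>"
    unfolding x ext_pull_def by blast
qed

text \<open>A morphism of extensions over 0 kills i, hence has the form s p, and s is then a section
  of p'. Conversely, each section s defines such a morphism s p.\<close>

lemma ext_push_zero:
  assumes O: "A \<in> Obj C" "Y \<in> Obj C" and \<xi>: "\<xi> \<subseteq> extensions C A Y" "\<xi> \<noteq> {}"
  shows "ext_push C A Y \<zero>\<^bsub>Hom C Y Y\<^esub> \<xi> = split_extensions A Y"
proof (intro equalityI subsetI)
  fix x assume "x \<in> ext_push C A Y \<zero>\<^bsub>Hom C Y Y\<^esub> \<xi>"
  then obtain i' B' p' i B p b where x: "x = (i', B', p')" and e': "(i', B', p') \<in> extensions C A Y"
    and mem: "(i, B, p) \<in> \<xi>" and b: "b \<in> mor C B B'" "b \<cdot> i = i' \<cdot> \<zero>\<^bsub>Hom C Y Y\<^esub>" "p' \<cdot> b = p"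
    unfolding ext_push_def by blast
  have e: "(i, B, p) \<in> extensions C A Y" using mem \<xi> by blast
  note E = extensionsD[OF e] and E' = extensionsD[OF e']
  have "b \<cdot> i = \<zero>\<^bsub>Hom C Y B'\<^esub>" using b E' O cmp_zero_right by simp
  then obtain s where s: "s \<in> mor C A B'" "s \<cdot> p = b"
    using E(5) E'(1) b(1) unfolding is_cokernel_def by metis
  have ps: "p' \<cdot> s \<in> mor C A A" using s E' O cmp_closed by blast
  have "(p' \<cdot> s) \<cdot> p = ident C A \<cdot> p"
    using s b E E' O cmp_assoc[of B A B' A p s p'] ident_cmp by simp
  then have "p' \<cdot> s = ident C A"
    by (rule is_epi_cancel[OF cokernel_is_epi[OF E(5) O(2) E(1,2)] O(1) ps ident_closed[OF O(1)]])
  then show "x \<in> split_extensions A Y"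
    unfolding x split_extensions_def using e' s(1) by blast
next
  fix x assume "x \<in> split_extensions A Y"
  then obtain i' B' p' s where x: "x = (i', B', p')" and e': "(i', B', p') \<in> extensions C A Y"
    and s: "s \<in> mor C A B'" "p' \<cdot> s = ident C A"
    unfolding split_extensions_def by blast
  obtain i B p where mem: "(i, B, p) \<in> \<xi>" using \<xi>(2) by auto
  then have e: "(i, B, p) \<in> extensions C A Y" using \<xi> by blast
  note E = extensionsD[OF e] and E' = extensionsD[OF e']
  have "(s \<cdot> p) \<cdot> i = i' \<cdot> \<zero>\<^bsub>Hom C Y Y\<^esub>"
    using E E' O s cmp_assoc[of Y B A B' i p s] cmp_zero_right[of Y A B' s] cmp_zero_right[of Y Y B' i']
    by simp
  moreover have "p' \<cdot> (s \<cdot> p) = p"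
    using E E' O s cmp_assoc[of B A B' A p s p'] ident_cmp by simp
  moreover have "s \<cdot> p \<in> mor C B B'" using E E' O s cmp_closed by blast
  ultimately show "x \<in> ext_push C A Y \<zero>\<^bsub>Hom C Y Y\<^esub> \<xi>"
    unfolding x ext_push_def using mem e' by blast
qed

lemma biproduct_extension:
  assumes O: "X \<in> Obj C" "Y \<in> Obj C" and S: "is_biproduct C Y X S i1 i2 p1 p2"
  shows "(i1, S, p2) \<in> extensions C X Y"
proof -
  have S: "S \<in> Obj C" "i1 \<in> mor C Y S" "i2 \<in> mor C X S" "p1 \<in> mor C S Y" "p2 \<in> mor C S X"
    "p1 \<cdot> i1 = ident C Y" "p2 \<cdot> i2 = ident C X" "p2 \<cdot> i1 = \<zero>\<^bsub>Hom C Y X\<^esub>"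
    "i1 \<cdot> p1 \<oplus>\<^bsub>Hom C S S\<^esub> i2 \<cdot> p2 = ident C S"
    using S by (auto simp: is_biproduct_def)
  have e1: "i1 \<cdot> p1 \<in> mor C S S" and e2: "i2 \<cdot> p2 \<in> mor C S S" using S O cmp_closed by blast+
  have "\<exists>!s. s \<in> mor C T Y \<and> i1 \<cdot> s = t"
    if t: "T \<in> Obj C" "t \<in> mor C T S" "p2 \<cdot> t = \<zero>\<^bsub>Hom C T X\<^esub>" for T t
  proof (rule ex1I)
    have p1t: "p1 \<cdot> t \<in> mor C T Y" using t S O cmp_closed by blast
    have "t = ident C S \<cdot> t" using t S ident_cmp by simp
    also have "\<dots> = (i1 \<cdot> p1) \<cdot> t \<oplus>\<^bsub>Hom C T S\<^esub> (i2 \<cdot> p2) \<cdot> t"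
      unfolding S(9)[symmetric] using S t e1 e2 by (intro cmp_add_left) auto
    also have "(i2 \<cdot> p2) \<cdot> t = \<zero>\<^bsub>Hom C T S\<^esub>"
      using S t O cmp_assoc[of T S X S t p2 i2] cmp_zero_right[of T X S i2] by simp
    also have "(i1 \<cdot> p1) \<cdot> t \<oplus>\<^bsub>Hom C T S\<^esub> \<zero>\<^bsub>Hom C T S\<^esub> = (i1 \<cdot> p1) \<cdot> t"
      using S t e1 cmp_closed by (intro add_zero) blast+
    also have "\<dots> = i1 \<cdot> (p1 \<cdot> t)" using S t O by (intro cmp_assoc[symmetric]) auto
    finally show "p1 \<cdot> t \<in> mor C T Y \<and> i1 \<cdot> (p1 \<cdot> t) = t" using p1t by simp
    show "s = p1 \<cdot> t" if "s \<in> mor C T Y \<and> i1 \<cdot> s = t" for s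
      using that S t O cmp_assoc[of T Y S Y s i1 p1] ident_cmp by auto
  qed
  then have ker: "is_kernel C S X p2 Y i1"
    unfolding is_kernel_def using S O by blast
  have "\<exists>!s. s \<in> mor C X T \<and> s \<cdot> p2 = t"
    if t: "T \<in> Obj C" "t \<in> mor C S T" "t \<cdot> i1 = \<zero>\<^bsub>Hom C Y T\<^esub>" for T t
  proof (rule ex1I)
    have ti2: "t \<cdot> i2 \<in> mor C X T" using t S O cmp_closed by blast
    have "t = t \<cdot> ident C S" using t S cmp_ident by simp
    also have "\<dots> = t \<cdot> (i1 \<cdot> p1) \<oplus>\<^bsub>Hom C S T\<^esub> t \<cdot> (i2 \<cdot> p2)"
      unfolding S(9)[symmetric] using S t e1 e2 by (intro cmp_add_right) auto
    also have "t \<cdot> (i1 \<cdot> p1) = \<zero>\<^bsub>Hom C S T\<^esub>"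
      using S t O cmp_assoc[of S Y S T p1 i1 t] cmp_zero_left[of S Y T p1] by simp
    also have "\<zero>\<^bsub>Hom C S T\<^esub> \<oplus>\<^bsub>Hom C S T\<^esub> t \<cdot> (i2 \<cdot> p2) = t \<cdot> (i2 \<cdot> p2)"
      using S t e2 cmp_closed by (intro add_zero) blast+
    also have "\<dots> = (t \<cdot> i2) \<cdot> p2" using S t O by (intro cmp_assoc) auto
    finally show "t \<cdot> i2 \<in> mor C X T \<and> (t \<cdot> i2) \<cdot> p2 = t" using ti2 by simp
    show "s = t \<cdot> i2" if "s \<in> mor C X T \<and> s \<cdot> p2 = t" for s
      using that S t O cmp_assoc[of X S X T i2 p2 s] cmp_ident by auto
  qed
  then have "is_cokernel C Y S i1 X p2"
    unfolding is_cokernel_def using S O by blast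
  with ker S show ?thesis by (auto simp: extensions_def)
qed

lemma Ext1_carrier_memD:
  assumes "\<xi> \<in> carrier (Ext1 C X Y)" "X \<in> Obj C" "Y \<in> Obj C"
  shows "\<xi> \<subseteq> extensions C X Y" "\<xi> \<noteq> {}"
proof -
  obtain x where x: "x \<in> extensions C X Y" "\<xi> = ext_equiv C X Y `` {x}"
    using assms(1) by (auto simp: Ext1_def elim: quotientE)
  obtain i B p where ibp: "x = (i, B, p)" by (cases x)
  note E = extensionsD[OF x(1)[unfolded ibp]]
  have "is_iso C B B (ident C B)"
    using E ident_closed cmp_ident unfolding is_iso_def by blast
  then have "(x, x) \<in> ext_equiv C X Y"
    unfolding ibp ext_equiv_def using x(1) ibp E assms cmp_ident ident_cmp by blast
  then show "\<xi> \<noteq> {}" using x by blast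
  show "\<xi> \<subseteq> extensions C X Y" unfolding x(2) ext_equiv_def by blast
qed

text \<open>Supplies a class for the scalar 0 to act on, which is how the zero class is reached
  later.\<close>

lemma Ext1_carrier_nonempty:
  assumes "abelian_category k C" "X \<in> Obj C" "Y \<in> Obj C"
  shows "carrier (Ext1 C X Y) \<noteq> {}"
proof -
  obtain S i1 i2 p1 p2 where "is_biproduct C Y X S i1 i2 p1 p2"
    using assms unfolding abelian_category_def by metis
  then show ?thesis
    using biproduct_extension assms by (force simp: Ext1_def quotient_def)
qed

section \<open>Consequences of Serre duality\<close>

text \<open>Naturality of \<theta> : \<sigma> \<tau> -> 1 gives f \<theta>(A) = \<theta>(V)
  \<sigma>(\<tau> f) = 0, and \<theta>(A) has a right inverse.\<close>

lemma equivalence_reflects_zero: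
  assumes \<tau>: "linear_auto_equivalence k C \<tau>" and O: "A \<in> Obj C" "V \<in> Obj C"
    and f: "f \<in> mor C A V" and 0: "FMor \<tau> A V f = \<zero>\<^bsub>Hom C (FObj \<tau> A) (FObj \<tau> V)\<^esub>"
  shows "f = \<zero>\<^bsub>Hom C A V\<^esub>"
proof -
  obtain \<sigma> where \<sigma>: "linear_endofunctor k C \<sigma>" "naturally_iso_to_identity C (comp_endofunctor \<sigma> \<tau>)"
    using \<tau> unfolding linear_auto_equivalence_def by blast
  have \<tau>O: "FObj \<tau> A \<in> Obj C" "FObj \<tau> V \<in> Obj C"
    using \<tau> O unfolding linear_auto_equivalence_def linear_endofunctor_def by blast+
  let ?A = "FObj \<sigma> (FObj \<tau> A)" and ?V = "FObj \<sigma> (FObj \<tau> V)"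
  have \<sigma>O: "?A \<in> Obj C" "?V \<in> Obj C"
    using \<sigma>(1) \<tau>O unfolding linear_endofunctor_def by blast+
  let ?\<sigma> = "FMor \<sigma> (FObj \<tau> A) (FObj \<tau> V)"
  have "?\<sigma> \<in> lin_maps k (Hom C (FObj \<tau> A) (FObj \<tau> V)) (Hom C ?A ?V)"
    using \<sigma>(1) \<tau>O unfolding linear_endofunctor_def by blast
  then have \<sigma>0: "?\<sigma> \<zero>\<^bsub>Hom C (FObj \<tau> A) (FObj \<tau> V)\<^esub> = \<zero>\<^bsub>Hom C ?A ?V\<^esub>"
    using \<tau>O \<sigma>O by (intro lin_maps_zero[of k] hom_module)
  obtain \<theta> where \<theta>I: "\<forall>X\<in>Obj C. is_iso C (FObj \<sigma> (FObj \<tau> X)) X (\<theta> X)"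
    and \<theta>N: "\<forall>X\<in>Obj C. \<forall>Y\<in>Obj C. \<forall>f\<in>mor C X Y.
      \<theta> Y \<cdot> FMor \<sigma> (FObj \<tau> X) (FObj \<tau> Y) (FMor \<tau> X Y f) = f \<cdot> \<theta> X"
    using \<sigma>(2) unfolding naturally_iso_to_identity_def comp_endofunctor_def by auto
  have \<theta>: "is_iso C (FObj \<sigma> (FObj \<tau> X)) X (\<theta> X)" if "X \<in> Obj C" for X using \<theta>I that ..
  have nat: "\<theta> V \<cdot> ?\<sigma> (FMor \<tau> A V f) = f \<cdot> \<theta> A" using \<theta>N O f by blast
  obtain \<theta>' where \<theta>': "\<theta>' \<in> mor C A ?A" "\<theta> A \<cdot> \<theta>' = ident C A"
    using \<theta>[OF O(1)] unfolding is_iso_def by blast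
  have \<theta>m: "\<theta> A \<in> mor C ?A A" "\<theta> V \<in> mor C ?V V"
    using \<theta> O unfolding is_iso_def by blast+
  have "f \<cdot> \<theta> A = \<zero>\<^bsub>Hom C ?A V\<^esub>"
    using nat unfolding 0 \<sigma>0 using cmp_zero_right \<theta>m O \<sigma>O by simp
  then have "f \<cdot> (\<theta> A \<cdot> \<theta>') = \<zero>\<^bsub>Hom C A V\<^esub>"
    using cmp_assoc[of A ?A A V \<theta>' "\<theta> A" f] cmp_zero_left[of A ?A V \<theta>'] \<theta>m \<theta>' O \<sigma>O f by simp
  then show ?thesis using \<theta>'(2) cmp_ident O f by simp
qed

text \<open>
  With \<open>Y = \<tau> A\<close> let \<open>l \<in> D Ext\<^sup>1(A, Y)\<close> correspond to the identity of \<open>Y\<close>. Then \<open>\<tau> f\<close> corresponds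
  to \<open>\<xi> \<mapsto> l (f\<^sup>* \<xi>)\<close>, which vanishes if \<open>f\<close> lifts along every epimorphism, as then all \<open>f\<^sup>* \<xi>\<close> split.
\<close>

lemma nonzero_morphism_avoids_epi:
  assumes ab: "abelian_category k C" and E: "module k E" and serre: "has_serre_duality k E C"
    and O: "A \<in> Obj C" "V \<in> Obj C" and f: "f \<in> mor C A V" "f \<noteq> \<zero>\<^bsub>Hom C A V\<^esub>"
  obtains B p where "B \<in> Obj C" "is_epi C B V p" "\<And>g. g \<in> mor C A B \<Longrightarrow> f \<noteq> p \<cdot> g"
proof (rule ccontr)
  assume "\<not> thesis"
  with that have factors: "\<exists>g\<in>mor C A B. f = p \<cdot> g" if "B \<in> Obj C" "is_epi C B V p" for B p
    using that by blast
  interpret E: module k E by (rule E)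
  obtain \<tau> \<phi> where \<tau>: "linear_auto_equivalence k C \<tau>"
    and \<phi>_all: "\<forall>X\<in>Obj C. \<forall>Y\<in>Obj C.
      \<phi> X Y \<in> lin_isos k (dual k E (Ext1 C X Y)) (Hom C Y (FObj \<tau> X))"
    and nat: "\<forall>X\<in>Obj C. \<forall>X'\<in>Obj C. \<forall>Y\<in>Obj C. \<forall>a\<in>mor C X X'. \<forall>l\<in>carrier (dual k E (Ext1 C X Y)).
      \<phi> X' Y (\<lambda>\<xi>\<in>carrier (Ext1 C X' Y). l (ext_pull C X Y a \<xi>)) = FMor \<tau> X X' a \<cdot> \<phi> X Y l"
    using serre unfolding has_serre_duality_def by (elim exE conjE) (rule that)
  have \<phi>: "\<phi> X Y \<in> lin_isos k (dual k E (Ext1 C X Y)) (Hom C Y (FObj \<tau> X))"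
    if "X \<in> Obj C" "Y \<in> Obj C" for X Y using \<phi>_all that by blast
  have endo: "linear_endofunctor k C \<tau>" using \<tau> unfolding linear_auto_equivalence_def by blast
  define Y where "Y = FObj \<tau> A"
  have Y: "Y \<in> Obj C" and \<tau>V: "FObj \<tau> V \<in> Obj C"
    using endo O unfolding linear_endofunctor_def Y_def by blast+
  interpret YV: module k "Hom C Y (FObj \<tau> V)" using Y \<tau>V by (intro hom_module)
  have "bij_betw (\<phi> A Y) (carrier (dual k E (Ext1 C A Y))) (mor C Y Y)"
    using \<phi>[OF O(1) Y] by (simp add: lin_isos_def Y_def)
  then obtain l where l: "l \<in> carrier (dual k E (Ext1 C A Y))" "\<phi> A Y l = ident C Y"
    using ident_closed[OF Y] unfolding bij_betw_def by (metis imageE)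
  have "bij_betw (\<phi> V Y) (carrier (dual k E (Ext1 C V Y))) (mor C Y (FObj \<tau> V))"
    using \<phi>[OF O(2) Y] by (simp add: lin_isos_def)
  \<comment> \<open>Surjectivity provides some element l0 of the dual. The zero functional will be
    written as 0 times l0, so that homogeneity of \<open>\<phi> V Y\<close> alone determines its
    image.\<close>
  then have "\<zero>\<^bsub>Hom C Y (FObj \<tau> V)\<^esub> \<in> \<phi> V Y ` carrier (dual k E (Ext1 C V Y))"
    using zero_closed[OF Y \<tau>V] by (simp add: bij_betw_def)
  then obtain l0 where l0: "l0 \<in> carrier (dual k E (Ext1 C V Y))" "\<phi> V Y l0 = \<zero>\<^bsub>Hom C Y (FObj \<tau> V)\<^esub>"
    by (elim imageE) (rule that, simp_all)
  obtain \<xi>0 where \<xi>0: "\<xi>0 \<in> carrier (Ext1 C A Y)"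
    using Ext1_carrier_nonempty[OF ab O(1) Y] by blast
  interpret YY: module k "Hom C Y Y" using Y by (intro hom_module)
  have "l (ext_pull C A Y f \<xi>) = \<zero>\<^bsub>E\<^esub>" if \<xi>: "\<xi> \<in> carrier (Ext1 C V Y)" for \<xi>
  proof -
    have "ext_pull C A Y f \<xi> = split_extensions A Y"
    proof (rule ext_pull_eq_split_extensions[OF O Y Ext1_carrier_memD[OF \<xi> O(2) Y]])
      fix i B p assume "(i, B, p) \<in> \<xi>"
      then have "(i, B, p) \<in> extensions C V Y" using Ext1_carrier_memD[OF \<xi> O(2) Y] by blast
      note E = extensionsD[OF this]
      show "\<exists>g\<in>mor C A B. f = p \<cdot> g"
        by (rule factors[OF E(1) cokernel_is_epi[OF E(5) Y E(1,2)]])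
    qed
    \<comment> \<open>The split extensions are also what the scalar 0 makes of any class, so l
      vanishes on them by homogeneity.\<close>
    also have "\<dots> = ext_push C A Y \<zero>\<^bsub>Hom C Y Y\<^esub> \<xi>0"
      by (rule ext_push_zero[OF O(1) Y Ext1_carrier_memD[OF \<xi>0 O(1) Y], symmetric])
    also have "\<dots> = \<zero>\<^bsub>k\<^esub> \<odot>\<^bsub>Ext1 C A Y\<^esub> \<xi>0"
      using ident_closed[OF Y] by (simp add: Ext1_def)
    also have "l (\<zero>\<^bsub>k\<^esub> \<odot>\<^bsub>Ext1 C A Y\<^esub> \<xi>0) = \<zero>\<^bsub>k\<^esub> \<odot>\<^bsub>E\<^esub> l \<xi>0"
      using l(1) \<xi>0 by (auto simp: dual_def lin_maps_def)
    also have "\<dots> = \<zero>\<^bsub>E\<^esub>"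
      using l(1) \<xi>0 by (intro E.smult_l_null) (auto simp: dual_def lin_maps_def hom_def)
    finally show ?thesis .
  qed
  then have "(\<lambda>\<xi>\<in>carrier (Ext1 C V Y). l (ext_pull C A Y f \<xi>)) = (\<lambda>\<xi>\<in>carrier (Ext1 C V Y). \<zero>\<^bsub>E\<^esub>)"
    by (intro restrict_ext)
  also have "\<dots> = \<zero>\<^bsub>k\<^esub> \<odot>\<^bsub>dual k E (Ext1 C V Y)\<^esub> l0"
    using l0(1) by (auto simp: dual_def lin_maps_def hom_def fun_eq_iff restrict_def Pi_iff)
  finally have "FMor \<tau> A V f \<cdot> ident C Y = \<phi> V Y (\<zero>\<^bsub>k\<^esub> \<odot>\<^bsub>dual k E (Ext1 C V Y)\<^esub> l0)"
    using nat[rule_format, OF O Y f(1) l(1)] l(2) by simp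
  also have "\<dots> = \<zero>\<^bsub>k\<^esub> \<odot>\<^bsub>Hom C Y (FObj \<tau> V)\<^esub> \<phi> V Y l0"
    using \<phi>[OF O(2) Y] l0(1) by (auto simp: lin_isos_def lin_maps_def)
  also have "\<dots> = \<zero>\<^bsub>Hom C Y (FObj \<tau> V)\<^esub>" unfolding l0(2) by simp
  finally have "FMor \<tau> A V f \<cdot> ident C Y = \<zero>\<^bsub>Hom C Y (FObj \<tau> V)\<^esub>" .
  moreover have "FMor \<tau> A V \<in> lin_maps k (Hom C A V) (Hom C Y (FObj \<tau> V))"
    using endo O unfolding linear_endofunctor_def Y_def by blast
  then have "FMor \<tau> A V f \<in> mor C Y (FObj \<tau> V)"
    using f by (auto simp: lin_maps_def hom_def)
  ultimately have "FMor \<tau> A V f = \<zero>\<^bsub>Hom C (FObj \<tau> A) (FObj \<tau> V)\<^esub>"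
    using cmp_ident Y \<tau>V by (simp add: Y_def)
  then show False using equivalence_reflects_zero[OF \<tau> O f(1)] f(2) by blast
qed

text \<open>
  Choose an epimorphism for which the image of \<open>Hom(A, T)\<close> in \<open>Hom(A, V)\<close> is minimal. A nonzero
  element of that image avoids some epimorphism \<open>p\<close>, and pulling back along \<open>p\<close> would shrink it.
\<close>

lemma epi_annihilating_morphisms:
  assumes art: "artinian_cring k" and ab: "abelian_category k C" and fin: "hom_finite k C"
    and E: "module k E" and serre: "has_serre_duality k E C"
    and O: "A \<in> Obj C" "V \<in> Obj C"
  obtains T t where "T \<in> Obj C" "is_epi C T V t" "\<And>g. g \<in> mor C A T \<Longrightarrow> t \<cdot> g = \<zero>\<^bsub>Hom C A V\<^esub>"
proof -
  interpret AV: module_over k "Hom C A V" by (rule hom_module_over) fact+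
  define \<S> where "\<S> = {im_Hom C A T t |T t. T \<in> Obj C \<and> is_epi C T V t}"
  have "\<S> \<noteq> {}" unfolding \<S>_def using O is_epi_ident by blast
  moreover have "submodule N k (Hom C A V)" if "N \<in> \<S>" for N
    using that im_Hom_submodule O unfolding \<S>_def by (auto simp: is_epi_def)
  moreover have "fg_module k (Hom C A V)" using fin O by (auto simp: hom_finite_def)
  ultimately obtain N where N: "N \<in> \<S>" and min: "\<And>N'. N' \<in> \<S> \<Longrightarrow> N' \<subseteq> N \<Longrightarrow> N' = N"
    using AV.submodule_minimal_exists[OF art] by metis
  obtain T t where T: "T \<in> Obj C" "is_epi C T V t" and NT: "N = im_Hom C A T t"
    using N unfolding \<S>_def by blast
  have tm: "t \<in> mor C T V" using T by (simp add: is_epi_def)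
  have "t \<cdot> g = \<zero>\<^bsub>Hom C A V\<^esub>" if g: "g \<in> mor C A T" for g
  proof (rule ccontr)
    assume ne: "t \<cdot> g \<noteq> \<zero>\<^bsub>Hom C A V\<^esub>"
    have tg: "t \<cdot> g \<in> mor C A V" using g tm T O cmp_closed by blast
    obtain B p where B: "B \<in> Obj C" "is_epi C B V p" and avoid: "\<And>h. h \<in> mor C A B \<Longrightarrow> t \<cdot> g \<noteq> p \<cdot> h"
      using nonzero_morphism_avoids_epi[OF ab E serre O tg ne] by metis
    have pm: "p \<in> mor C B V" using B by (simp add: is_epi_def)
    obtain P q q' where P: "P \<in> Obj C" "q \<in> mor C P B" "q' \<in> mor C P T" "p \<cdot> q = t \<cdot> q'" "is_epi C P V (t \<cdot> q')"
      using epis_have_common_refinement[OF ab B(1) T(1) O(2) B(2) T(2)] by metis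
    have "(t \<cdot> q') \<cdot> h \<in> im_Hom C A T t" if "h \<in> mor C A P" for h
    proof -
      have "(t \<cdot> q') \<cdot> h = t \<cdot> (q' \<cdot> h)" using cmp_assoc[of A P T V h q' t] that P T O tm by simp
      moreover have "q' \<cdot> h \<in> mor C A T" using that P T O cmp_closed by blast
      ultimately show ?thesis unfolding im_Hom_def by blast
    qed
    then have "im_Hom C A P (t \<cdot> q') \<subseteq> N" unfolding NT by (auto simp: im_Hom_def)
    \<comment> \<open>By minimality the refined epimorphism still has the whole image N. It equals p
      q, so the element t g of N would factor through p.\<close>
    then have "im_Hom C A P (t \<cdot> q') = N" using P by (intro min) (auto simp: \<S>_def)
    then have "t \<cdot> g \<in> im_Hom C A P (p \<cdot> q)" using g unfolding P(4) NT by (simp add: im_Hom_def)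
    then obtain h where h: "h \<in> mor C A P" "t \<cdot> g = (p \<cdot> q) \<cdot> h" unfolding im_Hom_def by blast
    then have "t \<cdot> g = p \<cdot> (q \<cdot> h)" using cmp_assoc[of A P B V h q p] P B O pm by simp
    moreover have "q \<cdot> h \<in> mor C A B" using h P B O cmp_closed by blast
    ultimately show False using avoid by blast
  qed
  with T show ?thesis using that by blast
qed

end


section \<open>Right determined morphisms and dualizing varieties\<close>

lemma op_cat_simps [simp]:
  "Obj (op_cat C) = Obj C" "Hom (op_cat C) X Y = Hom C Y X"
  "f \<cdot>\<^bsub>op_cat C\<^esub> g = g \<cdot>\<^bsub>C\<^esub> f" "ident (op_cat C) = ident C"
  by (simp_all add: op_cat_def)

context klinear_category
begin

lemma not_right_determined_if_epi_annihilates: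
  assumes O: "A \<in> Obj C" "U \<in> Obj C" "V \<in> Obj C" "T \<in> Obj C" and \<alpha>: "\<alpha> \<in> mor C U V" "\<not> is_epi C U V \<alpha>"
    and t: "is_epi C T V t" "\<And>g. g \<in> mor C A T \<Longrightarrow> t \<cdot> g = \<zero>\<^bsub>Hom C A V\<^esub>"
  shows "\<not> right_determined C U V \<alpha> A"
proof
  assume det: "right_determined C U V \<alpha> A"
  have tm: "t \<in> mor C T V" using t by (simp add: is_epi_def)
  have "\<zero>\<^bsub>Hom C A V\<^esub> \<in> im_Hom C A U \<alpha>"
    using cmp_zero_right[of A U V \<alpha>] zero_closed[of A U] O \<alpha>(1) unfolding im_Hom_def by force
  then have "im_Hom C A T t \<subseteq> im_Hom C A U \<alpha>"
    using t(2) by (auto simp: im_Hom_def)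
  then obtain t' where t': "t' \<in> mor C T U" "t = \<alpha> \<cdot> t'"
    using det O tm unfolding right_determined_def by blast
  have "is_epi C U V \<alpha>"
    unfolding is_epi_def
  proof (intro conjI ballI impI)
    fix W r s assume W: "W \<in> Obj C" "r \<in> mor C V W" "s \<in> mor C V W" "r \<cdot> \<alpha> = s \<cdot> \<alpha>"
    then have "r \<cdot> t = s \<cdot> t"
      unfolding t'(2) using O \<alpha> t' cmp_assoc[of T U V W t' \<alpha> r] cmp_assoc[of T U V W t' \<alpha> s] by simp
    then show "r = s" by (rule is_epi_cancel[OF t(1) W(1-3)])
  qed fact
  with \<alpha>(2) show False ..
qed

section \<open>The functor Hom(-, V) in encoded form\<close>

text \<open>Each object has its own encoding, since the coefficient vectors used later refer to
  generators of the individual module Hom(X, V).\<close>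

definition transported_hom_functor ::
    "('o \<Rightarrow> 'm \<Rightarrow> 'v) \<Rightarrow> 'o \<Rightarrow> ('o, 'm, ('k, 'v) module, 'v \<Rightarrow> 'v) lfunctor" where
  "transported_hom_functor \<iota> V =
     \<lparr>FObj = (\<lambda>X. transport_module (\<iota> X) (Hom C X V)),
      FMor = (\<lambda>X Y f x. \<iota> Y (inv_into (mor C X V) (\<iota> X) x \<cdot> f))\<rparr>"

context
  fixes \<iota> :: "'o \<Rightarrow> 'm \<Rightarrow> 'v" and V :: 'o
  assumes V: "V \<in> Obj C" and inj: "\<And>X. X \<in> Obj C \<Longrightarrow> inj_on (\<iota> X) (mor C X V)"
begin

lemma transported_simps:
  assumes "X \<in> Obj C"
  shows "carrier (transport_module (\<iota> X) (Hom C X V)) = \<iota> X ` mor C X V"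
    "\<zero>\<^bsub>transport_module (\<iota> X) (Hom C X V)\<^esub> = \<iota> X \<zero>\<^bsub>Hom C X V\<^esub>"
    "\<lbrakk>x \<in> mor C X V; y \<in> mor C X V\<rbrakk> \<Longrightarrow>
      \<iota> X x \<oplus>\<^bsub>transport_module (\<iota> X) (Hom C X V)\<^esub> \<iota> X y = \<iota> X (x \<oplus>\<^bsub>Hom C X V\<^esub> y)"
    "x \<in> mor C X V \<Longrightarrow> c \<odot>\<^bsub>transport_module (\<iota> X) (Hom C X V)\<^esub> \<iota> X x = \<iota> X (c \<odot>\<^bsub>Hom C X V\<^esub> x)"
  using transport_module_simps[OF hom_module[OF assms V] inj[OF assms]] by blast+

lemma transported_FObj: "FObj (transported_hom_functor \<iota> V) X = transport_module (\<iota> X) (Hom C X V)"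
  by (simp add: transported_hom_functor_def)

lemma transported_FMor:
  "\<lbrakk>X \<in> Obj C; x \<in> mor C X V\<rbrakk> \<Longrightarrow> FMor (transported_hom_functor \<iota> V) X Y f (\<iota> X x) = \<iota> Y (x \<cdot> f)"
  using inj by (simp add: transported_hom_functor_def)

lemma transported_hom_functor_kmod:
  assumes fin: "hom_finite k C"
  shows "kmod_functor k (op_cat C) (transported_hom_functor \<iota> V)"
proof -
  have fg: "fg_module k (transport_module (\<iota> X) (Hom C X V))" if "X \<in> Obj C" for X
    using that fin V inj by (intro transport_module_fg hom_module) (auto simp: hom_finite_def)
  have smult_closed: "c \<odot>\<^bsub>Hom C X Y\<^esub> f \<in> mor C X Y"
    if "X \<in> Obj C" "Y \<in> Obj C" "c \<in> carrier k" "f \<in> mor C X Y" for X Y c f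
    using module.smult_closed[OF hom_module[OF that(1,2)] that(3,4)] .
  have lin: "FMor (transported_hom_functor \<iota> V) X Y f
      \<in> lin_maps k (transport_module (\<iota> X) (Hom C X V)) (transport_module (\<iota> Y) (Hom C Y V))"
    if X: "X \<in> Obj C" and Y: "Y \<in> Obj C" and f: "f \<in> mor C Y X" for X Y f
  proof -
    have c: "x \<cdot> f \<in> mor C Y V" if "x \<in> mor C X V" for x
      using that X Y V f cmp_closed by blast
    show ?thesis
      unfolding lin_maps_def hom_def using X Y V f c
      by (auto simp: transported_simps transported_FMor add_closed smult_closed cmp_add_left cmp_smult_left)
  qed
  show ?thesis
    unfolding kmod_functor_def op_cat_simps transported_FObj
  proof (intro conjI ballI)
    show "fg_module k (transport_module (\<iota> X) (Hom C X V))" if "X \<in> Obj C" for X by (rule fg[OF that])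
    show "FMor (transported_hom_functor \<iota> V) X Y f
      \<in> lin_maps k (transport_module (\<iota> X) (Hom C X V)) (transport_module (\<iota> Y) (Hom C Y V))"
      if "X \<in> Obj C" "Y \<in> Obj C" "f \<in> mor C Y X" for X Y f by (rule lin[OF that])
  next
    fix X x assume X: "X \<in> Obj C" and "x \<in> carrier (transport_module (\<iota> X) (Hom C X V))"
    then obtain y where "y \<in> mor C X V" "x = \<iota> X y" by (auto simp: transported_simps)
    then show "FMor (transported_hom_functor \<iota> V) X X (ident C X) x = x"
      using X V by (simp add: transported_FMor cmp_ident)
  next
    fix X Y Z f g x
    assume O: "X \<in> Obj C" "Y \<in> Obj C" "Z \<in> Obj C" and fg: "f \<in> mor C Y X" "g \<in> mor C Z Y"
      and "x \<in> carrier (transport_module (\<iota> X) (Hom C X V))"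
    then obtain y where y: "y \<in> mor C X V" "x = \<iota> X y" by (auto simp: transported_simps)
    have "y \<cdot> f \<in> mor C Y V" using y O V fg cmp_closed by blast
    then show "FMor (transported_hom_functor \<iota> V) X Z (f \<cdot> g) x =
        FMor (transported_hom_functor \<iota> V) Y Z g (FMor (transported_hom_functor \<iota> V) X Y f x)"
      using y O V fg cmp_assoc[of Z Y X V g f y] by (simp add: transported_FMor)
  next
    fix X Y f g x
    assume O: "X \<in> Obj C" "Y \<in> Obj C" and fg: "f \<in> mor C Y X" "g \<in> mor C Y X"
      and "x \<in> carrier (transport_module (\<iota> X) (Hom C X V))"
    then obtain y where y: "y \<in> mor C X V" "x = \<iota> X y" by (auto simp: transported_simps)
    have "y \<cdot> f \<in> mor C Y V" "y \<cdot> g \<in> mor C Y V" using y O V fg cmp_closed by blast+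
    then show "FMor (transported_hom_functor \<iota> V) X Y (f \<oplus>\<^bsub>Hom C Y X\<^esub> g) x =
        FMor (transported_hom_functor \<iota> V) X Y f x \<oplus>\<^bsub>transport_module (\<iota> Y) (Hom C Y V)\<^esub>
        FMor (transported_hom_functor \<iota> V) X Y g x"
      using y O V fg by (simp add: transported_FMor transported_simps cmp_add_right)
  next
    fix X Y c f x
    assume O: "X \<in> Obj C" "Y \<in> Obj C" and fg: "c \<in> carrier k" "f \<in> mor C Y X"
      and "x \<in> carrier (transport_module (\<iota> X) (Hom C X V))"
    then obtain y where y: "y \<in> mor C X V" "x = \<iota> X y" by (auto simp: transported_simps)
    have "y \<cdot> f \<in> mor C Y V" using y O V fg cmp_closed by blast
    then show "FMor (transported_hom_functor \<iota> V) X Y (c \<odot>\<^bsub>Hom C Y X\<^esub> f) x =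
        c \<odot>\<^bsub>transport_module (\<iota> Y) (Hom C Y V)\<^esub> FMor (transported_hom_functor \<iota> V) X Y f x"
      using y O V fg by (simp add: transported_FMor transported_simps cmp_smult_right)
  qed
qed

text \<open>The presentation is Hom(-, Z) -> Hom(-, V) -> F -> 0 with the zero object Z, the
  encoding \<iota> itself being the second map.\<close>

lemma transported_hom_functor_finitely_presented:
  assumes Z: "is_zero_object C Z"
  shows "finitely_presented k (op_cat C) (transported_hom_functor \<iota> V)"
proof -
  have ZO: "Z \<in> Obj C" using Z by (simp add: is_zero_object_def)
  have \<eta>: "nat_transf k (op_cat C) (hom_functor (op_cat C) Z) (hom_functor (op_cat C) V)
      (\<lambda>X _. \<zero>\<^bsub>Hom C X V\<^esub>)"
    unfolding nat_transf_def
  proof (intro conjI ballI)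
    fix X assume "X \<in> Obj (op_cat C)"
    then interpret module k "Hom C X V" using V by (intro hom_module) auto
    show "(\<lambda>_. \<zero>\<^bsub>Hom C X V\<^esub>) \<in> lin_maps k (FObj (hom_functor (op_cat C) Z) X) (FObj (hom_functor (op_cat C) V) X)"
      by (auto simp: hom_functor_def lin_maps_def hom_def)
  qed (use V cmp_zero_left in \<open>auto simp: hom_functor_def\<close>)
  have \<pi>: "nat_transf k (op_cat C) (hom_functor (op_cat C) V) (transported_hom_functor \<iota> V) \<iota>"
    unfolding nat_transf_def
    by (auto simp: hom_functor_def transported_FObj transported_FMor lin_maps_def hom_def transported_simps)
  have "(\<lambda>_. \<zero>\<^bsub>Hom C X V\<^esub>) ` mor C X Z = {g \<in> mor C X V. \<iota> X g = \<iota> X \<zero>\<^bsub>Hom C X V\<^esub>}"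
    if X: "X \<in> Obj C" for X
  proof -
    have "{g \<in> mor C X V. \<iota> X g = \<iota> X \<zero>\<^bsub>Hom C X V\<^esub>} = {\<zero>\<^bsub>Hom C X V\<^esub>}"
      using inj[OF X] zero_closed[OF X V] by (auto simp: inj_on_def)
    moreover have "mor C X Z \<noteq> {}" using zero_closed[OF X ZO] by blast
    ultimately show ?thesis by auto
  qed
  then show ?thesis
    unfolding finitely_presented_def using \<eta> \<pi> ZO V
    by (intro bexI[of _ Z] bexI[of _ V] exI[of _ "\<lambda>X _. \<zero>\<^bsub>Hom C X V\<^esub>"] exI[of _ \<iota>])
      (auto simp: transported_FObj transported_simps)
qed

text \<open>
  A presentation makes \<open>D Hom(-, V)\<close> generated by a functional \<open>l\<close> on \<open>Hom(Y, V)\<close>, so every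
  functional on \<open>Hom(T, V)\<close> has the form \<open>v \<mapsto> l (v \<circ> h)\<close> with \<open>h : Y \<rightarrow> T\<close> and kills \<open>t\<close>.
\<close>

lemma dual_transported_hom_functor_generated:
  assumes fp: "finitely_presented k C (dual_functor k E (transported_hom_functor \<iota> V))" and E: "module k E"
  obtains Y where "Y \<in> Obj C"
    "\<And>T t \<mu>. \<lbrakk>T \<in> Obj C; t \<in> mor C T V; \<And>g. g \<in> mor C Y T \<Longrightarrow> t \<cdot> g = \<zero>\<^bsub>Hom C Y V\<^esub>;
      \<mu> \<in> lin_maps k (transport_module (\<iota> T) (Hom C T V)) E\<rbrakk> \<Longrightarrow> \<mu> (\<iota> T t) = \<zero>\<^bsub>E\<^esub>"
proof -
  let ?D = "dual_functor k E (transported_hom_functor \<iota> V)"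
  obtain Y \<pi> where Y: "Y \<in> Obj C" and \<pi>: "nat_transf k C (hom_functor C Y) ?D \<pi>"
    and surj: "\<forall>Z\<in>Obj C. \<pi> Z ` mor C Y Z = carrier (FObj ?D Z)"
    using fp unfolding finitely_presented_def
    by (elim bexE exE conjE) (rule that, assumption, assumption, blast)
  have DO: "FObj ?D X = dual k E (transport_module (\<iota> X) (Hom C X V))" for X
    by (simp add: dual_functor_def transported_FObj)
  define l where "l = \<pi> Y (ident C Y)"
  have "l \<in> carrier (FObj ?D Y)" using surj Y ident_closed[OF Y] unfolding l_def by blast
  then have l: "l \<in> lin_maps k (transport_module (\<iota> Y) (Hom C Y V)) E"
    unfolding DO by (simp add: dual_def)
  have l0: "l (\<iota> Y \<zero>\<^bsub>Hom C Y V\<^esub>) = \<zero>\<^bsub>E\<^esub>"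
    using lin_maps_zero[OF transport_module_module[OF hom_module[OF Y V] inj[OF Y]] E l] Y
    by (simp add: transported_simps)
  have "\<mu> (\<iota> T t) = \<zero>\<^bsub>E\<^esub>"
    if T: "T \<in> Obj C" "t \<in> mor C T V" and ann: "\<And>g. g \<in> mor C Y T \<Longrightarrow> t \<cdot> g = \<zero>\<^bsub>Hom C Y V\<^esub>"
      and \<mu>: "\<mu> \<in> lin_maps k (transport_module (\<iota> T) (Hom C T V)) E" for T t \<mu>
  proof -
    let ?c = "carrier (transport_module (\<iota> T) (Hom C T V))"
    \<comment> \<open>Elements of \<open>dual\<close> are extensional, hence the restriction of
      \<mu> to the carrier.\<close>
    have "restrict \<mu> ?c \<in> carrier (FObj ?D T)"
    proof -
      interpret T: module k "transport_module (\<iota> T) (Hom C T V)"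
        using T V inj by (intro transport_module_module hom_module)
      show ?thesis
        using \<mu> unfolding DO by (auto simp: dual_def lin_maps_def hom_def)
    qed
    then obtain h where h: "h \<in> mor C Y T" "\<pi> T h = restrict \<mu> ?c"
      using surj T by (metis imageE)
    \<comment> \<open>The Yoneda argument: naturality of \<pi> at h expresses
      \<open>\<pi> T h\<close> through the value l at the identity of Y.\<close>
    have "\<pi> T (h \<cdot> ident C Y) = FMor ?D Y T h l"
      using \<pi> Y T h(1) ident_closed[OF Y] unfolding nat_transf_def l_def hom_functor_def by simp
    then have "\<pi> T h = FMor ?D Y T h l" using cmp_ident[OF Y T(1) h(1)] by simp
    then have "restrict \<mu> ?c (\<iota> T t) = FMor ?D Y T h l (\<iota> T t)" using h(2) by simp
    then show "\<mu> (\<iota> T t) = \<zero>\<^bsub>E\<^esub>"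
      using T h ann l0
      by (simp add: dual_functor_def transported_FObj transported_FMor transported_simps)
  qed
  with Y show ?thesis using that by blast
qed

end

end

theorem mainTheorem4:
  fixes k :: "'k ring" and E :: "('k, 'e) module" and C :: "('k, 'o, 'm) lincat"
  assumes "artinian_cring k"
    and "minimal_injective_cogenerator k E"
    and "abelian_category k C"
    and "hom_finite k C"
    and "\<exists>Z\<in>Obj C. \<not> is_zero_object C Z"
    and "has_serre_duality k E C"
  shows "(\<forall>U\<in>Obj C. \<forall>V\<in>Obj C. \<forall>\<alpha>\<in>mor C U V. \<not> is_epi C U V \<alpha> \<longrightarrow>
            \<not> (\<exists>A\<in>Obj C. right_determined C U V \<alpha> A))
       \<and> \<not> has_right_determined_morphisms C
       \<and> \<not> dualizing_variety k E C"
proof -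
  interpret klinear_category k C using assms(3) by (simp add: abelian_category_def)
  have cog: "cogenerator_module k E" using assms(2) by (simp add: minimal_injective_cogenerator_def)
  then have E: "module k E" by (simp add: cogenerator_module_def)
  have annihilate: "\<exists>T t. T \<in> Obj C \<and> is_epi C T V t \<and> (\<forall>g\<in>mor C A T. t \<cdot>\<^bsub>C\<^esub> g = \<zero>\<^bsub>Hom C A V\<^esub>)"
    if "A \<in> Obj C" "V \<in> Obj C" for A V
    using epi_annihilating_morphisms[OF assms(1,3,4) E assms(6) that] by metis
  have not_det: "\<not> right_determined C U V \<alpha> A"
    if "U \<in> Obj C" "V \<in> Obj C" "\<alpha> \<in> mor C U V" "\<not> is_epi C U V \<alpha>" "A \<in> Obj C" for U V \<alpha> A
    using annihilate[OF that(5,2)] not_right_determined_if_epi_annihilates that by metis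
  obtain V where V: "V \<in> Obj C" "\<not> is_zero_object C V" using assms(5) by blast
  have id_ne: "ident C V \<noteq> \<zero>\<^bsub>Hom C V V\<^esub>"
  proof
    assume id: "ident C V = \<zero>\<^bsub>Hom C V V\<^esub>"
    have "f = \<zero>\<^bsub>Hom C X V\<^esub>" if "X \<in> Obj C" "f \<in> mor C X V" for X f
      using ident_cmp[OF that(1) V(1) that(2)] cmp_zero_left[OF that(1) V(1) V(1) that(2)] id by simp
    moreover have "f = \<zero>\<^bsub>Hom C V X\<^esub>" if "X \<in> Obj C" "f \<in> mor C V X" for X f
      using cmp_ident[OF V(1) that] cmp_zero_right[OF V(1) V(1) that] id by simp
    ultimately have "is_zero_object C V"
      unfolding is_zero_object_def using V zero_closed by metis
    with V show False by simp
  qed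
  \<comment> \<open>The zero endomorphism of the nonzero object V is the morphism at which (RC1)
    fails.\<close>
  have zV: "\<zero>\<^bsub>Hom C V V\<^esub> \<in> mor C V V" using V zero_closed by blast
  have not_epi: "\<not> is_epi C V V \<zero>\<^bsub>Hom C V V\<^esub>"
    using is_epi_cancel_zero[OF _ V(1) V(1) V(1) ident_closed[OF V(1)]] ident_cmp[OF V(1) V(1) zV] id_ne by blast
  have "\<not> has_right_determined_morphisms C"
    unfolding has_right_determined_morphisms_def using not_det V(1) zV not_epi by blast
  moreover have "\<not> dualizing_variety k E C"
  proof
    assume dual: "dualizing_variety k E C"
    have "\<exists>\<iota> :: 'm \<Rightarrow> 'k univ_elt. inj_on \<iota> (mor C X V)" if "X \<in> Obj C" for X
      using module_over.fg_module_embeds_in_univ_elt[OF hom_module_over[OF that V(1)]]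
        assms(4) that V unfolding hom_finite_def by metis
    then obtain \<iota> :: "'o \<Rightarrow> 'm \<Rightarrow> 'k univ_elt" where \<iota>: "\<And>X. X \<in> Obj C \<Longrightarrow> inj_on (\<iota> X) (mor C X V)"
      by metis
    obtain Z where Z: "is_zero_object C Z" using assms(3) by (auto simp: abelian_category_def)
    have "finitely_presented k C (dual_functor k E (transported_hom_functor \<iota> V))"
      using dual transported_hom_functor_kmod[OF V(1) \<iota> assms(4)]
        transported_hom_functor_finitely_presented[OF V(1) \<iota> Z]
      unfolding dualizing_variety_def by blast
    then obtain Y where Y: "Y \<in> Obj C" and kill:
      "\<And>T t \<mu>. \<lbrakk>T \<in> Obj C; t \<in> mor C T V; \<And>g. g \<in> mor C Y T \<Longrightarrow> t \<cdot>\<^bsub>C\<^esub> g = \<zero>\<^bsub>Hom C Y V\<^esub>;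
        \<mu> \<in> lin_maps k (transport_module (\<iota> T) (Hom C T V)) E\<rbrakk> \<Longrightarrow> \<mu> (\<iota> T t) = \<zero>\<^bsub>E\<^esub>"
      using dual_transported_hom_functor_generated[OF V(1) \<iota> _ E] by metis
    obtain T t where T: "T \<in> Obj C" "is_epi C T V t"
      and ann: "\<And>g. g \<in> mor C Y T \<Longrightarrow> t \<cdot>\<^bsub>C\<^esub> g = \<zero>\<^bsub>Hom C Y V\<^esub>"
      using annihilate[OF Y V(1)] by blast
    have t: "t \<in> mor C T V" using T by (simp add: is_epi_def)
    \<comment> \<open>Otherwise the identity of V, composed with the epimorphism t, would be zero
      and hence zero itself.\<close>
    have "t \<noteq> \<zero>\<^bsub>Hom C T V\<^esub>"
      using is_epi_cancel_zero[OF T(2,1) V(1) V(1) ident_closed[OF V(1)]] ident_cmp[OF T(1) V(1) t] id_ne by auto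
    then have "\<iota> T t \<noteq> \<iota> T \<zero>\<^bsub>Hom C T V\<^esub>"
      using \<iota>[OF T(1)] t zero_closed[OF T(1) V(1)] by (auto simp: inj_on_def)
    moreover have "module k (transport_module (\<iota> T) (Hom C T V))"
      by (rule transport_module_module[OF hom_module[OF T(1) V(1)] \<iota>[OF T(1)]])
    ultimately obtain \<mu> where "\<mu> \<in> lin_maps k (transport_module (\<iota> T) (Hom C T V)) E" "\<mu> (\<iota> T t) \<noteq> \<zero>\<^bsub>E\<^esub>"
      using cogenerator_separates_points[OF cog, of "transport_module (\<iota> T) (Hom C T V)" "\<iota> T t"]
        transported_simps[OF V(1) \<iota> T(1)] t by (metis imageI)
    then show False using kill[OF T(1) t ann] by blast
  qed
  ultimately show ?thesis using not_det by blast
qed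

end
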